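(* Let $S$ be a string of length $n$ over a finite alphabet $\Sigma$. A longest subsequence-repeated subsequence of $S$ can be computed in $O(n^6)$ time.
   Context: A subsequence of $S$ is a string obtained by deleting some letters of $S$. A subsequence $S'$ of $S$ is a subsequence-repeated subsequence (SRS) of $S$ if it has the form $x_1^{d_1}x_2^{d_2}\cdots x_k^{d_k}$, where each $x_i$ is a (nonempty) subsequence of $S$, $x_j\neq x_{j+1}$ for all $j\in[k-1]$, and $d_i\ge 2$ for all $i\in[k]$; here $x^d$ denotes $d$ consecutive copies of the string $x$. The longest subsequence-repeated subsequence (LSRS) problem asks for an SRS of $S$ of maximum length. *)

theory Defs
  imports Complex_Main "HOL-Library.Sublist" "HOL-Library.Landau_Symbols"
begin

section \<open>Subsequence-repeated subsequences\<close>

definition word_power :: "'a list \<Rightarrow> nat \<Rightarrow> 'a list" where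
  "word_power x d = concat (replicate d x)"

text \<open>
  The blocks \<open>(x\<^sub>i, d\<^sub>i)\<close> are collected in a list, indexed from 0.  The empty list of blocks
  is admitted, so the empty string is a subsequence-repeated subsequence of every string; it is
  the only one exactly if no letter occurs twice, and hence a longest one always exists.
\<close>

definition is_SRS :: "'a list \<Rightarrow> 'a list \<Rightarrow> bool" where
  "is_SRS S S' \<longleftrightarrow> subseq S' S \<and>
     (\<exists>bs :: ('a list \<times> nat) list.
        S' = concat (map (\<lambda>(x, d). word_power x d) bs) \<and>
        (\<forall>(x, d) \<in> set bs. x \<noteq> [] \<and> subseq x S \<and> d \<ge> 2) \<and>
        (\<forall>j. Suc j < length bs \<longrightarrow> fst (bs ! j) \<noteq> fst (bs ! Suc j)))"

definition is_LSRS :: "'a list \<Rightarrow> 'a list \<Rightarrow> bool" where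
  "is_LSRS S S' \<longleftrightarrow> is_arg_max length (is_SRS S) S'"


section \<open>A word RAM\<close>

text \<open>
  Running times are measured on a word RAM whose programs are written in structured form.
  Registers and memory cells hold \<open>w\<close>-bit words, i.e. numbers below \<open>2 ^ w\<close>, and memory is
  addressed by words.  Arithmetic is modulo \<open>2 ^ w\<close>, comparisons yield 0 or 1, and every
  operation takes one unit of time.  A program does not depend on \<open>w\<close>.
\<close>

datatype binop = Plus | Minus | Times | Less | Equal

datatype exp = Const nat | Reg nat | Load exp | Bin binop exp exp

datatype com =
    Skip
  | Assign nat exp
  | Store exp exp  \<comment> \<open>address, value\<close>
  | Seq com com
  | If exp com com
  | While exp com

type_synonym state = "(nat \<Rightarrow> nat) \<times> (nat \<Rightarrow> nat)"  \<comment> \<open>registers, memory\<close>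

text \<open>The second argument of \<open>Minus\<close> is below \<open>2 ^ w\<close>, so the subtraction is never truncated.\<close>

fun binop_val :: "nat \<Rightarrow> binop \<Rightarrow> nat \<Rightarrow> nat \<Rightarrow> nat" where
  "binop_val w Plus a b = (a + b) mod 2 ^ w"
| "binop_val w Minus a b = (a + (2 ^ w - b)) mod 2 ^ w"
| "binop_val w Times a b = (a * b) mod 2 ^ w"
| "binop_val w Less a b = of_bool (a < b) mod 2 ^ w"
| "binop_val w Equal a b = of_bool (a = b) mod 2 ^ w"

fun exp_val :: "nat \<Rightarrow> exp \<Rightarrow> state \<Rightarrow> nat" where
  "exp_val w (Const k) s = k mod 2 ^ w"
| "exp_val w (Reg r) s = fst s r"
| "exp_val w (Load e) s = snd s (exp_val w e s)"
| "exp_val w (Bin f e1 e2) s = binop_val w f (exp_val w e1 s) (exp_val w e2 s)"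

fun exp_time :: "exp \<Rightarrow> nat" where
  "exp_time (Const k) = 1"
| "exp_time (Reg r) = 1"
| "exp_time (Load e) = 1 + exp_time e"
| "exp_time (Bin f e1 e2) = 1 + exp_time e1 + exp_time e2"

text \<open>\<open>exec w c s t s'\<close>: started in \<open>s\<close>, program \<open>c\<close> halts in \<open>s'\<close> after exactly \<open>t\<close> time units.\<close>

inductive exec :: "nat \<Rightarrow> com \<Rightarrow> state \<Rightarrow> nat \<Rightarrow> state \<Rightarrow> bool" for w where
  Skip: "exec w Skip s 1 s"
| Assign: "exec w (Assign r e) s (1 + exp_time e) ((fst s)(r := exp_val w e s), snd s)"
| Store: "exec w (Store a e) s (1 + exp_time a + exp_time e)
            (fst s, (snd s)(exp_val w a s := exp_val w e s))"
| Seq: "exec w c1 s t1 s1 \<Longrightarrow> exec w c2 s1 t2 s2 \<Longrightarrow> exec w (Seq c1 c2) s (t1 + t2) s2"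
| IfTrue: "exp_val w e s \<noteq> 0 \<Longrightarrow> exec w c1 s t s' \<Longrightarrow>
            exec w (If e c1 c2) s (1 + exp_time e + t) s'"
| IfFalse: "exp_val w e s = 0 \<Longrightarrow> exec w c2 s t s' \<Longrightarrow>
            exec w (If e c1 c2) s (1 + exp_time e + t) s'"
| WhileFalse: "exp_val w e s = 0 \<Longrightarrow> exec w (While e c) s (1 + exp_time e) s"
| WhileTrue: "exp_val w e s \<noteq> 0 \<Longrightarrow> exec w c s t1 s1 \<Longrightarrow> exec w (While e c) s1 t2 s2 \<Longrightarrow>
            exec w (While e c) s (1 + exp_time e + t1 + t2) s2"

lemma exec_deterministic:
  assumes "exec w c s t s'" and "exec w c s u s''"
  shows "t = u \<and> s' = s''"
  using assms
proof (induction arbitrary: u s'' rule: exec.induct)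
  case (Skip s)
  then show ?case by cases auto
next
  case (Assign r e s)
  then show ?case by cases auto
next
  case (Store a e s)
  then show ?case by cases auto
next
  case (Seq c1 s t1 s1 c2 t2 s2)
  from Seq.prems obtain u1 r1 u2 where u: "u = u1 + u2"
    and 1: "exec w c1 s u1 r1" and 2: "exec w c2 r1 u2 s''"
    by cases
  from Seq.IH(1)[OF 1] 2 have "exec w c2 s1 u2 s''" by simp
  from Seq.IH(2)[OF this] Seq.IH(1)[OF 1] u show ?case by simp
next
  case (IfTrue e s c1 t s' c2)
  from IfTrue.prems show ?case by cases (use IfTrue.hyps in \<open>auto dest: IfTrue.IH\<close>)
next
  case (IfFalse e s c2 t s' c1)
  from IfFalse.prems show ?case by cases (use IfFalse.hyps in \<open>auto dest: IfFalse.IH\<close>)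
next
  case (WhileFalse e s c)
  from WhileFalse.prems show ?case by cases (use WhileFalse.hyps in auto)
next
  case (WhileTrue e s c t1 s1 t2 s2)
  note IH = WhileTrue.IH
  from WhileTrue.prems show ?case
  proof cases
    case WhileFalse
    then show ?thesis using WhileTrue.hyps by simp
  next
    case (WhileTrue u1 r1 u2)
    note 1 = local.WhileTrue(3) and 2 = local.WhileTrue(4)
    from IH(1)[OF 1] 2 have "exec w (While e c) s1 u2 s''" by simp
    from IH(2)[OF this] IH(1)[OF 1] local.WhileTrue(1) show ?thesis by simp
  qed
qed

text \<open>
  A string is stored with its length in register 0 and its letters, one word each, in the memory
  cells from 0 on.  Initially all other registers and cells are 0; at the end their contents are
  irrelevant.
\<close>

definition input_state :: "nat list \<Rightarrow> state" where
  "input_state S =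
     ((\<lambda>r. if r = 0 then length S else 0), (\<lambda>i. if i < length S then S ! i else 0))"

definition output_string :: "state \<Rightarrow> nat list" where
  "output_string s = map (snd s) [0..<fst s 0]"

text \<open>
  The usual requirement on the word size for inputs of length \<open>n\<close> over \<open>\<Sigma>\<close>: \<open>w\<close> is at least
  \<open>c * log 2 (n + 2)\<close>, and letters fit into a word.  Since a program has to work for all these
  \<open>w\<close>, including the smallest, it cannot rely on words of more than logarithmic length beyond
  what the letters themselves occupy.
\<close>

definition admissible_word_size :: "nat \<Rightarrow> nat set \<Rightarrow> nat \<Rightarrow> nat \<Rightarrow> bool" where
  "admissible_word_size c \<Sigma> n w \<longleftrightarrow> (n + 2) ^ c \<le> 2 ^ w \<and> \<Sigma> \<subseteq> {..<2 ^ w}"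

end

theory Submission imports Defs begin

text \<open>
  A power \<open>x\<^sup>d\<close> with \<open>d \<ge> 2\<close> is a product of squares and at most one cube of \<open>x\<close>, and equal neighbours
  can be merged, so the SRSs of \<open>S\<close> are exactly its subsequences that are products of squares and
  cubes.  The longest one for the suffix from \<open>i\<close> is found by dynamic programming: its first factor
  \<open>x\<^sup>3\<close> is spread over three segments with cut points \<open>i \<le> k \<le> l \<le> j\<close> (\<open>x\<^sup>2\<close> over two), where \<open>x\<close> is a longest
  common subsequence, and the rest is optimal for the suffix from \<open>j\<close>.  For fixed \<open>i, k, l\<close> a single
  table of size \<open>O(n\<^sup>3)\<close> yields the common subsequences for all \<open>j\<close>, whence the time \<open>O(n\<^sup>6)\<close>.
  Strings are shared linked lists on a heap, so that each table entry takes constant time.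
\<close>

section \<open>Products of squares and cubes\<close>

text \<open>Once neighbouring bases may be equal, factors no longer constrain each other: after a
  first factor ending at \<open>j\<close>, any optimal string for the suffix from \<open>j\<close>
  may follow. For fixed cut points the length is d times |x| plus |y|, so x and y are maximised
  independently. Restricting the exponents to 2 and 3 bounds the number of segments, and hence the
  dimension of the table. A table has fixed starts \<open>i\<close>, \<open>k\<close>,
  \<open>l\<close> and is indexed by the ends of the three slices; the cube with cuts
  \<open>k\<close>, \<open>l\<close>, \<open>j\<close> is read off at the ends
  \<open>(k, l, j)\<close>. Building a candidate string costs O(n), but there are only O(n^4)
  candidates, so the tables dominate the time. On the machine the obstacle is overflow: nodes are
  never freed, so the heap may grow in proportion to the running time, and addresses must still fit
  into words of logarithmic length.\<close>

inductive pow_concat :: "'a list \<Rightarrow> bool" where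
  Nil: "pow_concat []"
| Cons: "pow_concat y \<Longrightarrow> x \<noteq> [] \<Longrightarrow> d \<in> {2, 3} \<Longrightarrow> pow_concat (word_power x d @ y)"

lemma word_power_add: "word_power x (c + d) = word_power x c @ word_power x d"
  by (simp add: word_power_def replicate_add)

lemma word_power_Suc: "word_power x (Suc d) = x @ word_power x d"
  by (simp add: word_power_def)

lemma word_power_0 [simp]: "word_power x 0 = []"
  by (simp add: word_power_def)

lemma length_word_power [simp]: "length (word_power x d) = d * length x"
  by (induction d) (auto simp: word_power_Suc)

lemma pow_concat_power:
  assumes "pow_concat y" "x \<noteq> []" "d \<ge> 2"
  shows "pow_concat (word_power x d @ y)"
  using assms(3)
proof (induction d rule: less_induct)
  case (less d)
  show ?case
  proof (cases "d \<in> {2, 3}")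
    case True
    then show ?thesis using assms by (blast intro: pow_concat.Cons)
  next
    case False
    with less.prems have d: "d - 2 < d" "d - 2 \<ge> 2" "d = 2 + (d - 2)" by auto
    have "pow_concat (word_power x 2 @ word_power x (d - 2) @ y)"
      using less.IH[OF d(1,2)] assms(2) by (blast intro: pow_concat.Cons)
    then show ?thesis by (subst d(3)) (simp only: word_power_add append_assoc)
  qed
qed

text \<open>If the tail already begins with a block of the same base, its exponent absorbs
  \<open>d\<close>; otherwise a new block goes in front. Either way neighbouring bases stay
  distinct.\<close>

lemma pow_concat_blocks:
  assumes "pow_concat y"
  shows "\<exists>bs. y = concat (map (\<lambda>(x, d). word_power x d) bs) \<and>
           (\<forall>(x, d) \<in> set bs. x \<noteq> [] \<and> d \<ge> 2) \<and> distinct_adj (map fst bs)"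
  using assms
proof induction
  case Nil
  show ?case by (rule exI[of _ "[]"]) simp
next
  case (Cons y x d)
  then obtain bs where bs: "y = concat (map (\<lambda>(x, d). word_power x d) bs)"
    "\<forall>(x, d) \<in> set bs. x \<noteq> [] \<and> d \<ge> 2" "distinct_adj (map fst bs)" by blast
  have d: "d \<ge> 2" using Cons by auto
  show ?case
  proof (cases "\<exists>e bs'. bs = (x, e) # bs'")
    case True
    then obtain e bs' where e: "bs = (x, e) # bs'" by blast
    show ?thesis using bs d Cons.hyps unfolding e
      by (intro exI[of _ "(x, d + e) # bs'"]) (auto simp: word_power_add)
  next
    case False
    then show ?thesis using bs d Cons.hyps
      by (intro exI[of _ "(x, d) # bs"]) (cases bs; auto)
  qed
qed

lemma is_SRS_iff: "is_SRS S S' \<longleftrightarrow> subseq S' S \<and> pow_concat S'"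
proof
  assume "is_SRS S S'"
  then obtain bs where bs: "subseq S' S" "S' = concat (map (\<lambda>(x, d). word_power x d) bs)"
     "\<forall>(x, d) \<in> set bs. x \<noteq> [] \<and> d \<ge> 2"
    by (fastforce simp: is_SRS_def)
  have "pow_concat (concat (map (\<lambda>(x, d). word_power x d) bs))"
    using bs(3) by (induction bs) (auto intro: pow_concat.Nil pow_concat_power)
  with bs show "subseq S' S \<and> pow_concat S'" by simp
next
  assume *: "subseq S' S \<and> pow_concat S'"
  then obtain bs where bs: "S' = concat (map (\<lambda>(x, d). word_power x d) bs)"
    "\<forall>(x, d) \<in> set bs. x \<noteq> [] \<and> d \<ge> 2" "distinct_adj (map fst bs)"
    using pow_concat_blocks by blast
  \<comment> \<open>A base with positive exponent is a factor of \<open>S'\<close>, so this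
    condition is inherited from the embedding of \<open>S'\<close> into \<open>S\<close>.\<close>
  have "subseq x S" if "(x, d) \<in> set bs" for x d
  proof -
    from that bs(2) have "d \<ge> 2" by auto
    then have "word_power x d = x @ word_power x (d - 1)"
      by (metis One_nat_def Suc_pred' le_zero_eq not_gr_zero word_power_Suc zero_neq_numeral)
    moreover obtain ys zs where "bs = ys @ (x, d) # zs" using split_list[OF \<open>(x, d) \<in> set bs\<close>] by blast
    ultimately have "\<exists>u v. S' = u @ x @ v" by (auto simp: bs(1))
    then have "subseq x S'" by (metis list_emb_append2 subseq_append' subseq_order.order_refl list_emb_append_mono list_emb_Nil append_Nil2)
    with * show ?thesis by (meson subseq_order.trans)
  qed
  then show "is_SRS S S'" using * bs
    unfolding is_SRS_def distinct_adj_conv_nth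
    by (intro conjI exI[of _ bs]) auto
qed

section \<open>Longest common subsequences and optimal suffixes\<close>

definition lcs3 :: "'a list \<Rightarrow> 'a list \<Rightarrow> 'a list \<Rightarrow> 'a list \<Rightarrow> bool" where
  "lcs3 X Y Z u \<longleftrightarrow> is_arg_max length (\<lambda>v. subseq v X \<and> subseq v Y \<and> subseq v Z) u"

lemma lcs3_iff: "lcs3 X Y Z u \<longleftrightarrow> subseq u X \<and> subseq u Y \<and> subseq u Z \<and>
    (\<forall>v. subseq v X \<longrightarrow> subseq v Y \<longrightarrow> subseq v Z \<longrightarrow> length v \<le> length u)"
  by (auto simp: lcs3_def is_arg_max_def not_less)

lemma lcs3_Nil: "X = [] \<or> Y = [] \<or> Z = [] \<Longrightarrow> lcs3 X Y Z []"
  by (auto simp: lcs3_iff)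

lemma subseq_snocD:
  assumes "subseq v (X @ [p])"
  shows "subseq v X \<or> (\<exists>v'. v = v' @ [p] \<and> subseq v' X)"
proof -
  obtain v1 v2 where v: "v = v1 @ v2" "subseq v1 X" "subseq v2 [p]"
    using assms by (auto simp: subseq_append_iff)
  from v(3) have "v2 = [] \<or> v2 = [p]"
    by (cases v2) (auto split: if_splits simp: subseq_Cons2_iff)
  with v show ?thesis by auto
qed

text \<open>Dropping the last letter of a common subsequence of the extended strings leaves one of
  the original strings, so at most one letter can be gained.\<close>

lemma lcs3_snoc_eq:
  assumes "lcs3 X Y Z u"
  shows "lcs3 (X @ [p]) (Y @ [p]) (Z @ [p]) (u @ [p])"
  unfolding lcs3_iff
proof (intro conjI allI impI)
  fix v assume v: "subseq v (X @ [p])" "subseq v (Y @ [p])" "subseq v (Z @ [p])"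
  have "subseq (butlast v) U" if "subseq v (U @ [p])" for U
    using subseq_snocD[OF that] by (auto simp: butlast_append intro: subseq_order.trans
        dest: prefix_imp_subseq[OF prefixeq_butlast, THEN subseq_order.trans])
  then have "length (butlast v) \<le> length u" using assms v unfolding lcs3_iff by blast
  then show "length v \<le> length (u @ [p])" by simp
qed (use assms in \<open>auto simp: lcs3_iff\<close>)

lemma lcs3_snoc_neq:
  assumes "\<not> (p = q \<and> q = r)"
    and "lcs3 X (Y @ [q]) (Z @ [r]) u1" "lcs3 (X @ [p]) Y (Z @ [r]) u2" "lcs3 (X @ [p]) (Y @ [q]) Z u3"
    and "u \<in> {u1, u2, u3}" "length u1 \<le> length u" "length u2 \<le> length u" "length u3 \<le> length u"
  shows "lcs3 (X @ [p]) (Y @ [q]) (Z @ [r]) u"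
  unfolding lcs3_iff
proof (intro conjI allI impI)
  fix v assume v: "subseq v (X @ [p])" "subseq v (Y @ [q])" "subseq v (Z @ [r])"
  have "subseq v X \<or> subseq v Y \<or> subseq v Z"
    using subseq_snocD[OF v(1)] subseq_snocD[OF v(2)] subseq_snocD[OF v(3)] assms(1) by auto
  with v have "length v \<le> length u1 \<or> length v \<le> length u2 \<or> length v \<le> length u3"
    using assms(2-4) by (auto simp: lcs3_iff)
  then show "length v \<le> length u" using assms by auto
qed (use assms in \<open>auto simp: lcs3_iff\<close>)

section \<open>Cutting suffixes into segments\<close>

definition slice :: "'a list \<Rightarrow> nat \<Rightarrow> nat \<Rightarrow> 'a list" where
  "slice S i j = drop i (take j S)"

lemma slice_snoc: "i < a \<Longrightarrow> a \<le> length S \<Longrightarrow> slice S i a = slice S i (a - 1) @ [S ! (a - 1)]"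
  by (cases a) (auto simp: slice_def take_Suc_conv_app_nth)

lemma slice_self [simp]: "slice S i i = []"
  by (simp add: slice_def)

lemma slice_append_drop: "i \<le> k \<Longrightarrow> drop i S = slice S i k @ drop k S"
  unfolding slice_def by (metis append_take_drop_id drop_append drop_drop drop_take le_add_diff_inverse2 add.commute
      append_eq_append_conv2 drop_take)

lemma subseq_append_drop:
  "i \<le> k \<Longrightarrow> subseq x (slice S i k) \<Longrightarrow> subseq y (drop k S) \<Longrightarrow> subseq (x @ y) (drop i S)"
  by (simp add: slice_append_drop list_emb_append_mono)

text \<open>The cut \<open>k\<close> is placed where the portion of the suffix that hosts
  \<open>x\<close> ends.\<close>

lemma subseq_append_dropE:
  assumes "subseq (x @ y) (drop i S)" "i \<le> length S"
  obtains k where "i \<le> k" "k \<le> length S" "subseq x (slice S i k)" "subseq y (drop k S)"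
proof -
  obtain us vs where uv: "drop i S = us @ vs" "subseq x us" "subseq y vs"
    using assms(1) by (meson list_emb_appendD)
  have l: "length us + length vs + i = length S" using arg_cong[OF uv(1), of length] assms(2) by simp
  have "us = slice S i (i + length us)" "vs = drop (i + length us) S"
    using uv(1) by (simp_all add: slice_def drop_take flip: drop_drop) (metis append_eq_conv_conj add.commute drop_drop)
  with that[of "i + length us"] uv l show thesis by auto
qed

section \<open>Optimal strings for suffixes and the candidates that certify them\<close>

definition opt_suffix :: "'a list \<Rightarrow> nat \<Rightarrow> 'a list \<Rightarrow> bool" where
  "opt_suffix S i y \<longleftrightarrow> is_arg_max length (\<lambda>v. pow_concat v \<and> subseq v (drop i S)) y"

lemma opt_suffix_iff: "opt_suffix S i y \<longleftrightarrow> pow_concat y \<and> subseq y (drop i S) \<and>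
    (\<forall>v. pow_concat v \<longrightarrow> subseq v (drop i S) \<longrightarrow> length v \<le> length y)"
  by (auto simp: opt_suffix_def is_arg_max_def not_less)

lemma is_LSRS_iff: "is_LSRS S y \<longleftrightarrow> opt_suffix S 0 y"
  by (simp add: is_LSRS_def opt_suffix_def is_SRS_iff[abs_def] conj_commute)

text \<open>The candidates tried for the position \<open>i\<close>; squares are exhausted by the case \<open>l = k\<close>.\<close>

definition dominates :: "'a list \<Rightarrow> nat \<Rightarrow> nat \<Rightarrow> nat \<Rightarrow> nat \<Rightarrow> nat \<Rightarrow> bool" where
  "dominates S m i k l j \<longleftrightarrow> i < j \<longrightarrow>
     (\<forall>x y. subseq x (slice S i k) \<longrightarrow> subseq x (slice S l j) \<longrightarrow> pow_concat y \<longrightarrow> subseq y (drop j S) \<longrightarrow>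
       (subseq x (slice S k l) \<longrightarrow> 3 * length x + length y \<le> m) \<and>
       (subseq x (slice S k j) \<longrightarrow> 2 * length x + length y \<le> m))"

text \<open>A nonempty competitor is split into its first factor and its rest; the cut points of an
  embedding then select one instance of \<open>dominates\<close>, which quantifies over every base
  and every rest.\<close>

lemma opt_suffixI:
  assumes "pow_concat y" "subseq y (drop i S)" "i \<le> length S"
    and dom: "\<And>k l j. i \<le> k \<Longrightarrow> k \<le> l \<Longrightarrow> l \<le> j \<Longrightarrow> j \<le> length S \<Longrightarrow> dominates S (length y) i k l j"
  shows "opt_suffix S i y"
  unfolding opt_suffix_iff
proof (intro conjI allI impI)
  fix v assume v: "pow_concat v" "subseq v (drop i S)"
  from v(1) show "length v \<le> length y"
  proof cases
    case (Cons z x d)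
    show ?thesis
    proof (cases "d = 2")
      case True
      with Cons have "v = x @ x @ z" by (simp add: word_power_def eval_nat_numeral)
      then obtain k where k: "i \<le> k" "k \<le> length S" "subseq x (slice S i k)" "subseq (x @ z) (drop k S)"
        using v(2) assms(3) subseq_append_dropE by metis
      then obtain j where j: "k \<le> j" "j \<le> length S" "subseq x (slice S k j)" "subseq z (drop j S)"
        using subseq_append_dropE by metis
      \<comment> \<open>A nonempty base occupies letters, so the exclusion of \<open>i = j\<close>
        in \<open>dominates\<close> does no harm. With \<open>l = k\<close> the slices from
        \<open>k\<close> and from \<open>l\<close> coincide, which is why a square fits the scheme
        for cubes.\<close>
      have "i < j" using j k \<open>x \<noteq> []\<close> by (cases "i = j") (auto simp: slice_def)
      then show ?thesis using dom[of k k j] j k Cons True unfolding dominates_def by simp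
    next
      case False
      with Cons have "d = 3" by auto
      with Cons have "v = x @ x @ x @ z" by (simp add: word_power_def eval_nat_numeral)
      then obtain k where k: "i \<le> k" "k \<le> length S" "subseq x (slice S i k)" "subseq (x @ x @ z) (drop k S)"
        using v(2) assms(3) subseq_append_dropE by metis
      then obtain l where l: "k \<le> l" "l \<le> length S" "subseq x (slice S k l)" "subseq (x @ z) (drop l S)"
        using subseq_append_dropE by metis
      then obtain j where j: "l \<le> j" "j \<le> length S" "subseq x (slice S l j)" "subseq z (drop j S)"
        using subseq_append_dropE by metis
      have "i < j" using j k l \<open>x \<noteq> []\<close> by (cases "i = j") (auto simp: slice_def)
      then show ?thesis using dom[of k l j] j k l Cons \<open>d = 3\<close> unfolding dominates_def by simp
    qed
  qed simp
qed (use assms in auto)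

lemma cube_subseq:
  assumes "i \<le> k" "k \<le> l" "l \<le> j" "subseq x (slice S i k)" "subseq x (slice S k l)" "subseq x (slice S l j)"
    "subseq y (drop j S)"
  shows "subseq (word_power x 3 @ y) (drop i S)"
proof -
  have "subseq (x @ x @ x @ y) (drop i S)" using assms subseq_append_drop by metis
  then show ?thesis by (simp add: eval_nat_numeral word_power_Suc)
qed

lemma square_subseq:
  assumes "i \<le> k" "k \<le> j" "subseq x (slice S i k)" "subseq x (slice S k j)" "subseq y (drop j S)"
  shows "subseq (word_power x 2 @ y) (drop i S)"
proof -
  have "subseq (x @ x @ y) (drop i S)" using assms subseq_append_drop by metis
  then show ?thesis by (simp add: eval_nat_numeral word_power_Suc)
qed

text \<open>A longest common subsequence may be empty, while the introduction rule demands a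
  nonempty base; the power then simply vanishes.\<close>

lemma pow_concat_append:
  "pow_concat y \<Longrightarrow> d \<ge> 2 \<Longrightarrow> pow_concat (word_power x d @ y)"
  by (cases "x = []") (simp add: word_power_def, blast intro: pow_concat_power)

section \<open>Straight-line programs\<close>

declare split_paired_All [simp del] split_paired_Ex [simp del]

fun straight :: "com \<Rightarrow> bool" where
  "straight (Seq c1 c2) = (straight c1 \<and> straight c2)"
| "straight (If e c1 c2) = (straight c1 \<and> straight c2)"
| "straight (While e c) = False"
| "straight _ = True"

fun run :: "nat \<Rightarrow> com \<Rightarrow> state \<Rightarrow> state" where
  "run w (Assign r e) s = ((fst s)(r := exp_val w e s), snd s)"
| "run w (Store a e) s = (fst s, (snd s)(exp_val w a s := exp_val w e s))"
| "run w (Seq c1 c2) s = run w c2 (run w c1 s)"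
| "run w (If e c1 c2) s = (if exp_val w e s \<noteq> 0 then run w c1 s else run w c2 s)"
| "run w _ s = s"

text \<open>Adding up both branches of \<open>If\<close> gives an upper bound that is independent of
  the state.\<close>

fun straight_time :: "com \<Rightarrow> nat" where
  "straight_time (Assign r e) = 1 + exp_time e"
| "straight_time (Store a e) = 1 + exp_time a + exp_time e"
| "straight_time (Seq c1 c2) = straight_time c1 + straight_time c2"
| "straight_time (If e c1 c2) = 1 + exp_time e + straight_time c1 + straight_time c2"
| "straight_time _ = 1"

lemma exec_run: "straight c \<Longrightarrow> \<exists>t \<le> straight_time c. exec w c s t (run w c s)"
proof (induction c arbitrary: s)
  case (Seq c1 c2)
  obtain t1 where t1: "t1 \<le> straight_time c1" "exec w c1 s t1 (run w c1 s)"
    using Seq.IH(1)[of s] Seq.prems by auto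
  obtain t2 where t2: "t2 \<le> straight_time c2" "exec w c2 (run w c1 s) t2 (run w c2 (run w c1 s))"
    using Seq.IH(2)[of "run w c1 s"] Seq.prems by auto
  show ?case using t1 t2 exec.Seq[OF t1(2) t2(2)] by (auto intro!: exI[of _ "t1 + t2"])
next
  case (If e c1 c2)
  show ?case
  proof (cases "exp_val w e s = 0")
    case True
    obtain t where t: "t \<le> straight_time c2" "exec w c2 s t (run w c2 s)" using If.IH(2)[of s] If.prems by auto
    show ?thesis using t exec.IfFalse[OF True t(2), of c1] True
      by (auto intro!: exI[of _ "1 + exp_time e + t"])
  next
    case False
    obtain t where t: "t \<le> straight_time c1" "exec w c1 s t (run w c1 s)" using If.IH(1)[of s] If.prems by auto
    show ?thesis using t exec.IfTrue[OF False t(2), of c2] False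
      by (auto intro!: exI[of _ "1 + exp_time e + t"])
  qed
next
  case Skip
  show ?case using exec.Skip[of w s] by (intro exI[of _ 1]) simp
next
  case (Assign r e)
  show ?case using exec.Assign[of w r e s] by (intro exI[of _ "1 + exp_time e"]) simp
next
  case (Store a e)
  show ?case using exec.Store[of w a e s] by (intro exI[of _ "1 + exp_time a + exp_time e"]) simp
qed simp

section \<open>The program\<close>

text \<open>Memory layout for inputs of length \<open>n\<close>: the input occupies the cells below \<open>n\<close>, cell
  \<open>n + i\<close> points to the best string found for the suffix starting at \<open>i\<close>, \<open>tcell n a b c\<close> points to
  a longest common subsequence, and \<open>null_addr n\<close> is the empty list.  From \<open>null_addr n + 3\<close> on there is a
  heap of list nodes (length, head, pointer to the tail).\<close>

definition tcell :: "nat \<Rightarrow> nat \<Rightarrow> nat \<Rightarrow> nat \<Rightarrow> nat" where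
  "tcell n a b c = 2 * n + 1 + ((a * (n + 1) + b) * (n + 1) + c)"

definition null_addr :: "nat \<Rightarrow> nat" where
  "null_addr n = tcell n (n + 1) 0 0"

lemma digits_less:
  fixes a b A N :: nat
  assumes "a < A" "b < N"
  shows "a * N + b < A * N"
proof -
  have "a * N + b < Suc a * N" using assms(2) by simp
  also have "\<dots> \<le> A * N" using assms(1) by (intro mult_le_mono1) simp
  finally show ?thesis .
qed

lemma digits_inject:
  fixes a b a' b' N :: nat
  assumes "b < N" "b' < N"
  shows "a * N + b = a' * N + b' \<longleftrightarrow> a = a' \<and> b = b'"
proof
  assume eq: "a * N + b = a' * N + b'"
  have "(a * N + b) div N = a" "(a' * N + b') div N = a'" using assms by simp_all
  with eq show "a = a' \<and> b = b'" by simp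
qed simp

text \<open>The indices are digits to the base \<open>n + 1\<close>. The leading digit is
  unrestricted, so that \<open>a = n + 1\<close> can address the first cell after the table,
  \<open>null_addr n\<close>.\<close>

lemma tcell_inject:
  "b \<le> n \<Longrightarrow> c \<le> n \<Longrightarrow> b' \<le> n \<Longrightarrow> c' \<le> n \<Longrightarrow>
    tcell n a b c = tcell n a' b' c' \<longleftrightarrow> a = a' \<and> b = b' \<and> c = c'"
  by (simp add: tcell_def digits_inject del: mult_Suc_right)

lemma tcell_less_null: "a \<le> n \<Longrightarrow> b \<le> n \<Longrightarrow> c \<le> n \<Longrightarrow> tcell n a b c < null_addr n"
  using digits_less[of "a * (n + 1) + b" "(n + 1) * (n + 1)" c "n + 1"] digits_less[of a "n + 1" b "n + 1"]
  by (simp add: tcell_def null_addr_def)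

lemma less_tcell: "x \<le> 2 * n \<Longrightarrow> x < tcell n a b c"
  by (simp add: tcell_def)

lemma less_null_addr: "x \<le> 4 * n \<Longrightarrow> x < null_addr n"
  by (simp add: null_addr_def tcell_def)

text \<open>\<open>rN\<close> holds \<open>n + 1\<close>, \<open>rH\<close> the end of the heap, \<open>rZ\<close> the address \<open>null_addr n\<close>, and \<open>rT\<close> the base
  address \<open>2 * n + 1\<close> of the table; \<open>rP\<close> and \<open>rQ\<close> are list pointers.\<close>

abbreviation (input) rN :: nat where "rN \<equiv> 2"
abbreviation (input) rH :: nat where "rH \<equiv> 3"
abbreviation (input) rZ :: nat where "rZ \<equiv> 4"
abbreviation (input) rT :: nat where "rT \<equiv> 5"
abbreviation (input) rI :: nat where "rI \<equiv> 6"
abbreviation (input) rV :: nat where "rV \<equiv> 7"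
abbreviation (input) rK :: nat where "rK \<equiv> 8"
abbreviation (input) rL :: nat where "rL \<equiv> 9"
abbreviation (input) rA :: nat where "rA \<equiv> 10"
abbreviation (input) rB :: nat where "rB \<equiv> 11"
abbreviation (input) rC :: nat where "rC \<equiv> 12"
abbreviation (input) rJ :: nat where "rJ \<equiv> 13"
abbreviation (input) rP :: nat where "rP \<equiv> 14"
abbreviation (input) rQ :: nat where "rQ \<equiv> 15"
abbreviation (input) rX :: nat where "rX \<equiv> 16"

section \<open>Address expressions and program fragments\<close>

definition dec :: "exp \<Rightarrow> exp" where
  "dec e = Bin Minus e (Const 1)"

definition inc :: "exp \<Rightarrow> nat \<Rightarrow> exp" where
  "inc e k = Bin Plus e (Const k)"

definition best_at :: "exp \<Rightarrow> exp" where
  "best_at e = Bin Plus (Reg 0) e"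

definition lcs_at :: "exp \<Rightarrow> exp \<Rightarrow> exp \<Rightarrow> exp" where
  "lcs_at e f g = Bin Plus (Reg rT)
     (Bin Plus (Bin Times (Bin Plus (Bin Times e (Reg rN)) f) (Reg rN)) g)"

lemma exp_time_simps [simp]:
  "exp_time (dec e) = 2 + exp_time e"
  "exp_time (inc e k) = 2 + exp_time e"
  "exp_time (best_at e) = 2 + exp_time e"
  "exp_time (lcs_at e f g) = 8 + exp_time e + exp_time f + exp_time g"
  by (simp_all add: dec_def inc_def best_at_def lcs_at_def)

text \<open>Since \<open>rN\<close> holds \<open>n + 1\<close>, the counter runs up to
  \<open>n\<close> inclusive, as cut points do.\<close>

definition For :: "nat \<Rightarrow> exp \<Rightarrow> com \<Rightarrow> com" where
  "For v e c = Seq (Assign v e)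
     (While (Bin Less (Reg v) (Reg rN)) (Seq c (Assign v (inc (Reg v) 1))))"

text \<open>Keeping the length in each node makes comparing two strings a constant-time operation.
  Nodes are never changed after allocation, so tails can be shared.\<close>

definition push :: com where
  "push = Seq (Store (Reg rH) (inc (Load (Reg rP)) 1))
         (Seq (Store (inc (Reg rH) 1) (Reg rX))
         (Seq (Store (inc (Reg rH) 2) (Reg rP))
         (Seq (Assign rP (Reg rH)) (Assign rH (inc (Reg rH) 3)))))"

definition prepend_body :: com where
  "prepend_body = Seq (Assign rX (Load (inc (Reg rQ) 1))) (Seq push (Assign rQ (Load (inc (Reg rQ) 2))))"

text \<open>The empty list has the smallest address of all lists, so the test asks whether
  \<open>rQ\<close> is nonempty. Moving letters one by one reverses the list, which suits table
  entries: they are stored backwards.\<close>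

definition prepend :: com where
  "prepend = While (Bin Less (Reg rZ) (Reg rQ)) prepend_body"

primrec prepend_copies :: "exp \<Rightarrow> nat \<Rightarrow> com" where
  "prepend_copies e 0 = Skip"
| "prepend_copies e (Suc d) = Seq (prepend_copies e d) (Seq (Assign rQ (Load e)) prepend)"

definition try_power :: "exp \<Rightarrow> nat \<Rightarrow> com" where
  "try_power e d = Seq (Assign rP (Load (best_at (Reg rJ)))) (Seq (prepend_copies e d)
     (If (Bin Less (Load (Load (best_at (Reg rI)))) (Load (Reg rP)))
       (Store (best_at (Reg rI)) (Reg rP)) Skip))"

definition take_longer :: "exp \<Rightarrow> com" where
  "take_longer e = If (Bin Less (Load (Reg rP)) (Load (Load e))) (Assign rP (Load e)) Skip"

text \<open>Products of 0/1 comparisons serve as conjunctions. They evaluate all their arguments, so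
  the letters before the three ends are compared only after the outer test has made these ends
  positive.\<close>

definition fill_cell :: com where
  "fill_cell =
     If (Bin Times (Bin Less (Reg rI) (Reg rA)) (Bin Times (Bin Less (Reg rK) (Reg rB)) (Bin Less (Reg rL) (Reg rC))))
       (If (Bin Times (Bin Equal (Load (dec (Reg rA))) (Load (dec (Reg rB))))
                      (Bin Equal (Load (dec (Reg rB))) (Load (dec (Reg rC)))))
         (Seq (Assign rX (Load (dec (Reg rA))))
         (Seq (Assign rP (Load (lcs_at (dec (Reg rA)) (dec (Reg rB)) (dec (Reg rC)))))
         (Seq push (Store (lcs_at (Reg rA) (Reg rB) (Reg rC)) (Reg rP)))))
         (Seq (Assign rP (Load (lcs_at (dec (Reg rA)) (Reg rB) (Reg rC))))
         (Seq (take_longer (lcs_at (Reg rA) (dec (Reg rB)) (Reg rC)))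
         (Seq (take_longer (lcs_at (Reg rA) (Reg rB) (dec (Reg rC))))
              (Store (lcs_at (Reg rA) (Reg rB) (Reg rC)) (Reg rP))))))
       (Store (lcs_at (Reg rA) (Reg rB) (Reg rC)) (Reg rZ))"

definition fill_table :: com where
  "fill_table = For rA (Reg rI) (For rB (Reg rK) (For rC (Reg rL) fill_cell))"

text \<open>The cell \<open>(k, j, j)\<close> belongs to the slices from \<open>i\<close> to
  \<open>k\<close>, \<open>k\<close> to \<open>j\<close> and \<open>l\<close> to \<open>j\<close>.
  The first two already make its string the base of a legal square; for \<open>l = k\<close> the
  third is the same as the second, so no square is missed.\<close>

definition try_ends :: com where
  "try_ends = For rJ (Reg rL)
     (Seq (try_power (lcs_at (Reg rK) (Reg rL) (Reg rJ)) 3)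
          (try_power (lcs_at (Reg rK) (Reg rJ) (Reg rJ)) 2))"

definition start :: com where
  "start = Seq (Assign rI (Bin Minus (Reg 0) (Reg rV))) (Store (best_at (Reg rI)) (Reg rZ))"

text \<open>\<open>For\<close> counts upwards but suffixes must be solved from the right, so
  \<open>rV\<close> is the counter and \<open>start\<close> sets \<open>rI\<close> to
  \<open>n - rV\<close>.\<close>

definition solve :: com where
  "solve = For rV (Const 0) (Seq start
     (For rK (Reg rI) (For rL (Reg rK) (Seq fill_table try_ends))))"

text \<open>Cells outside the input are initially 0, so the cell at \<open>null_addr n\<close>
  already holds the length of the empty list. The heap begins after a full node for it.\<close>

definition init :: com where
  "init = Seq (Assign rN (inc (Reg 0) 1)) (Seq (Assign rT (Bin Plus (Reg 0) (Reg rN)))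
    (Seq (Assign rZ (lcs_at (Reg rN) (Const 0) (Const 0))) (Assign rH (inc (Reg rZ) 3))))"

definition write_body :: com where
  "write_body = Seq (Store (Reg rX) (Load (inc (Reg rP) 1)))
     (Seq (Assign rP (Load (inc (Reg rP) 2))) (Assign rX (inc (Reg rX) 1)))"

text \<open>Register 0 still holds \<open>n\<close>, and cell \<open>n\<close> is the entry of the
  suffix from 0, that is, of the whole string.\<close>

definition write_best :: com where
  "write_best = Seq (Seq (Assign rP (Load (Reg 0))) (Seq (Assign 0 (Load (Reg rP))) (Assign rX (Const 0))))
      (While (Bin Less (Reg rX) (Reg 0)) write_body)"

definition lsrs :: com where
  "lsrs = Seq init (Seq solve write_best)"

lemma straight_simps [simp]:
  "straight push" "straight prepend_body" "straight (take_longer e)" "straight fill_cell"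
  "straight start" "straight init" "straight write_body"
  by (simp_all add: push_def prepend_body_def take_longer_def fill_cell_def start_def init_def write_body_def)

section \<open>Timed Hoare triples\<close>

text \<open>\<open>M\<close> is a budget for addresses and numbers: results that stay within it are
  not affected by the reduction modulo \<open>2 ^ w\<close>. It is instantiated only at the very
  end.\<close>

locale lsrs_ram =
  fixes S :: "nat list" and w M :: nat
  assumes M_less: "M < 2 ^ w"
    and M_ge: "null_addr (length S) + 3 \<le> M"
begin

abbreviation n :: nat where "n \<equiv> length S"
abbreviation N :: nat where "N \<equiv> Suc n"

lemma null_less_M: "x \<le> null_addr n + 3 \<Longrightarrow> x \<le> M" and le_4n_M: "x \<le> 4 * n \<Longrightarrow> x \<le> M"
  using M_ge less_null_addr[of x n] by auto

lemma mod_word [simp]: "x \<le> M \<Longrightarrow> x mod 2 ^ w = x"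
  using M_less by simp

lemma word_size_pos [simp]: "0 < w"
  using M_less M_ge by (cases w) auto

lemma mod_word_small [simp]: "Suc 0 mod 2 ^ w = Suc 0" 
  using mod_word[of "Suc 0"] M_ge by (simp del: mod_word)

lemma of_bool_mod [simp]: "of_bool b mod 2 ^ w = (of_bool b :: nat)"
  by (cases b) auto

declare binop_val.simps(4,5) [simp del]
lemma binop_val_Less [simp]: "binop_val w Less a b = of_bool (a < b)"
  and binop_val_Equal [simp]: "binop_val w Equal a b = of_bool (a = b)"
  by (simp_all add: binop_val.simps)

text \<open>Subtraction adds \<open>2 ^ w - 1\<close>; as the value is positive, this wraps around
  exactly once.\<close>

lemma exp_val_dec [simp]:
  assumes "0 < exp_val w e s" "exp_val w e s \<le> M"
  shows "exp_val w (dec e) s = exp_val w e s - 1"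
proof -
  have "exp_val w e s + (2 ^ w - 1) = (exp_val w e s - 1) + 2 ^ w" using assms by simp
  then have "(exp_val w e s + (2 ^ w - 1)) mod 2 ^ w = exp_val w e s - 1"
    using assms by (simp only: mod_add_self2) simp
  then show ?thesis by (simp only: dec_def exp_val.simps binop_val.simps) simp
qed

lemma exp_val_inc [simp]:
  "exp_val w e s + k \<le> M \<Longrightarrow> exp_val w (inc e k) s = exp_val w e s + k"
  by (simp add: inc_def)

text \<open>Allocating three cells takes more than three time units, so the time bound also bounds the
  growth of the heap; the triples therefore need no separate treatment of overflow.\<close>

definition tri :: "(state \<Rightarrow> bool) \<Rightarrow> com \<Rightarrow> nat \<Rightarrow> (state \<Rightarrow> bool) \<Rightarrow> bool" where
  "tri P c \<tau> Q \<longleftrightarrow> (\<forall>s. P s \<longrightarrow> fst s rH + \<tau> \<le> M \<longrightarrow>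
     (\<exists>t s'. exec w c s t s' \<and> t \<le> \<tau> \<and> fst s' rH \<le> fst s rH + \<tau> \<and> Q s'))"

lemma triD:
  assumes "tri P c \<tau> Q" "P s" "fst s rH + \<tau> \<le> M"
  obtains t s' where "exec w c s t s'" "t \<le> \<tau>" "fst s' rH \<le> fst s rH + \<tau>" "Q s'"
  using assms unfolding tri_def by blast

lemma tri_conseq:
  assumes "tri P' c \<tau>' Q'" "\<And>s. P s \<Longrightarrow> P' s" "\<tau>' \<le> \<tau>" "\<And>s. Q' s \<Longrightarrow> Q s"
  shows "tri P c \<tau> Q"
  unfolding tri_def
proof (intro allI impI)
  fix s assume s: "P s" "fst s rH + \<tau> \<le> M"
  then have "P' s" "fst s rH + \<tau>' \<le> M" using assms(2,3) by auto
  from triD[OF assms(1) this] obtain t s' where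
    "exec w c s t s'" "t \<le> \<tau>'" "fst s' rH \<le> fst s rH + \<tau>'" "Q' s'" by blast
  then show "\<exists>t s'. exec w c s t s' \<and> t \<le> \<tau> \<and> fst s' rH \<le> fst s rH + \<tau> \<and> Q s'"
    using assms(3,4) by (intro exI[of _ t] exI[of _ s']) simp
qed

lemma tri_straight:
  assumes "straight c" "straight_time c \<le> \<tau>"
    and "\<And>s. P s \<Longrightarrow> fst s rH + \<tau> \<le> M \<Longrightarrow> fst (run w c s) rH \<le> fst s rH + \<tau> \<and> Q (run w c s)"
  shows "tri P c \<tau> Q"
  unfolding tri_def
proof (intro allI impI)
  fix s assume s: "P s" "fst s rH + \<tau> \<le> M"
  obtain t where "t \<le> straight_time c" "exec w c s t (run w c s)"
    using exec_run[OF assms(1)] by blast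
  then show "\<exists>t s'. exec w c s t s' \<and> t \<le> \<tau> \<and> fst s' rH \<le> fst s rH + \<tau> \<and> Q s'"
    using assms(2) assms(3)[OF s] by (intro exI[of _ t] exI[of _ "run w c s"]) simp
qed

lemma tri_Seq:
  assumes "tri P c1 \<tau>1 Q" "tri Q c2 \<tau>2 R"
  shows "tri P (Seq c1 c2) (\<tau>1 + \<tau>2) R"
  unfolding tri_def
proof (intro allI impI)
  fix s assume s: "P s" "fst s rH + (\<tau>1 + \<tau>2) \<le> M"
  obtain t1 s1 where 1: "exec w c1 s t1 s1" "t1 \<le> \<tau>1" "fst s1 rH \<le> fst s rH + \<tau>1" "Q s1"
    by (rule triD[OF assms(1) s(1)]) (use s(2) in simp)
  obtain t2 s2 where 2: "exec w c2 s1 t2 s2" "t2 \<le> \<tau>2" "fst s2 rH \<le> fst s1 rH + \<tau>2" "R s2"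
    by (rule triD[OF assms(2) 1(4)]) (use s(2) 1(3) in simp)
  show "\<exists>t s'. exec w (Seq c1 c2) s t s' \<and> t \<le> \<tau>1 + \<tau>2 \<and> fst s' rH \<le> fst s rH + (\<tau>1 + \<tau>2) \<and> R s'"
    using exec.Seq[OF 1(1) 2(1)] 1 2 by (intro exI[of _ "t1 + t2"] exI[of _ s2]) auto
qed

text \<open>The invariant is indexed by the number of remaining rounds, so termination, time and
  heap growth follow from a single induction.\<close>

lemma tri_While:
  assumes "\<And>k. tri (I (Suc k)) c \<tau> (I k)"
    and "\<And>k s. I k s \<Longrightarrow> fst s rH \<le> M \<Longrightarrow> exp_val w e s \<noteq> 0 \<longleftrightarrow> k > 0"
  shows "tri (I k) (While e c) (k * (1 + exp_time e + \<tau>) + (1 + exp_time e)) (I 0)"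
proof (induction k)
  case 0
  show ?case unfolding tri_def
  proof (intro allI impI)
    fix s assume s: "I 0 s" "fst s rH + (0 * (1 + exp_time e + \<tau>) + (1 + exp_time e)) \<le> M"
    then have "exp_val w e s = 0" using assms(2)[of 0 s] by simp
    note exec.WhileFalse[OF this, of c]
    then show "\<exists>t s'. exec w (While e c) s t s' \<and> t \<le> 0 * (1 + exp_time e + \<tau>) + (1 + exp_time e) \<and>
       fst s' rH \<le> fst s rH + (0 * (1 + exp_time e + \<tau>) + (1 + exp_time e)) \<and> I 0 s'"
      using s by (intro exI[of _ "1 + exp_time e"] exI[of _ s]) simp
  qed
next
  case (Suc k)
  let ?r = "k * (1 + exp_time e + \<tau>) + (1 + exp_time e)"
  show ?case unfolding tri_def
  proof (intro allI impI)
    fix s assume s: "I (Suc k) s" "fst s rH + (Suc k * (1 + exp_time e + \<tau>) + (1 + exp_time e)) \<le> M"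
    have e: "exp_val w e s \<noteq> 0" using assms(2)[of "Suc k" s] s by simp
    obtain t1 s1 where 1: "exec w c s t1 s1" "t1 \<le> \<tau>" "fst s1 rH \<le> fst s rH + \<tau>" "I k s1"
      by (rule triD[OF assms(1) s(1)]) (use s(2) in simp)
    obtain t2 s2 where 2: "exec w (While e c) s1 t2 s2" "t2 \<le> ?r" "fst s2 rH \<le> fst s1 rH + ?r" "I 0 s2"
      by (rule triD[OF Suc 1(4)]) (use s(2) 1(3) in simp)
    show "\<exists>t s'. exec w (While e c) s t s' \<and> t \<le> Suc k * (1 + exp_time e + \<tau>) + (1 + exp_time e) \<and>
       fst s' rH \<le> fst s rH + (Suc k * (1 + exp_time e + \<tau>) + (1 + exp_time e)) \<and> I 0 s'"
      using exec.WhileTrue[OF e 1(1) 2(1)] 1 2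
      by (intro exI[of _ "1 + exp_time e + t1 + t2"] exI[of _ s2]) auto
  qed
qed

text \<open>Each round costs 8 besides the body (4 for the test, 4 for the increment), and 6 more go
  to the initial assignment and the last test. With at most \<open>N\<close> rounds this is at most
  \<open>14 * N\<close>, whence the constant 14.\<close>

lemma tri_For:
  assumes body: "\<And>x. lo \<le> x \<Longrightarrow> x \<le> n \<Longrightarrow> tri (\<lambda>s. I x s \<and> fst s v = x) c (C * N ^ j) (\<lambda>s. I (Suc x) s \<and> fst s v = x)"
    and update: "\<And>x s y. I x s \<Longrightarrow> I x ((fst s)(v := y), snd s)"
    and N: "\<And>x s. I x s \<Longrightarrow> fst s rN = N"
    and lo: "\<And>s. I lo s \<Longrightarrow> exp_val w e s = lo" "exp_time e = 1" "lo \<le> n"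
    and v: "v \<noteq> rH"
  shows "tri (I lo) (For v e c) ((C + 14) * N ^ Suc j) (I N)"
proof -
  \<comment> \<open>With \<open>k\<close> rounds left the counter is \<open>N - k\<close>; the bound
    on \<open>k\<close> keeps it at least \<open>lo\<close>.\<close>
  let ?I = "\<lambda>k s. I (N - k) s \<and> fst s v = N - k \<and> k \<le> N - lo"
  have "tri (?I (Suc k)) (Seq c (Assign v (inc (Reg v) 1))) (C * N ^ j + 4) (?I k)" for k
  proof (cases "Suc k \<le> N - lo")
    case True
    have eq: "Suc (n - k) = N - k" using True by simp
    have k: "Suc (n - k) \<le> M" using null_less_M[of "Suc (n - k)"] less_null_addr[of n n] by linarith
    have "tri (?I (Suc k)) c (C * N ^ j) (\<lambda>s. I (N - k) s \<and> fst s v = N - Suc k)"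
      by (rule tri_conseq[OF body[of "N - Suc k"]]) (use True lo(3) in \<open>auto simp: eq\<close>)
    moreover have "tri (\<lambda>s. I (N - k) s \<and> fst s v = N - Suc k) (Assign v (inc (Reg v) 1)) 4 (?I k)"
    proof (rule tri_straight)
      fix s assume s: "I (N - k) s \<and> fst s v = N - Suc k"
      have "exp_val w (inc (Reg v) 1) s = N - k"
        using s True k by (simp add: Suc_diff_le)
      then show "fst (run w (Assign v (inc (Reg v) 1)) s) rH \<le> fst s rH + 4 \<and> ?I k (run w (Assign v (inc (Reg v) 1)) s)"
        using s v update[of "N - k" s "N - k"] True by simp
    qed simp_all
    ultimately show ?thesis by (rule tri_Seq)
  next
    case False
    then show ?thesis by (simp add: tri_def)
  qed
  moreover have "exp_val w (Bin Less (Reg v) (Reg rN)) s \<noteq> 0 \<longleftrightarrow> k > 0" if "?I k s" for k s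
    using that N[of "N - k" s] by (simp add: of_bool_def) linarith
  ultimately have loop: "tri (?I (N - lo)) (While (Bin Less (Reg v) (Reg rN)) (Seq c (Assign v (inc (Reg v) 1))))
      ((N - lo) * (1 + exp_time (Bin Less (Reg v) (Reg rN)) + (C * N ^ j + 4)) + (1 + exp_time (Bin Less (Reg v) (Reg rN))))
      (?I 0)"
    by (rule tri_While)
  have "tri (I lo) (Assign v e) 2 (?I (N - lo))"
  proof (rule tri_straight)
    fix s assume "I lo s"
    then show "fst (run w (Assign v e) s) rH \<le> fst s rH + 2 \<and> ?I (N - lo) (run w (Assign v e) s)"
      using lo(1)[of s] lo(3) v update[of lo s lo] by simp
  qed (use lo(2) in simp_all)
  from tri_Seq[OF this loop] have "tri (I lo) (For v e c) (2 +
      ((N - lo) * (1 + exp_time (Bin Less (Reg v) (Reg rN)) + (C * N ^ j + 4)) + (1 + exp_time (Bin Less (Reg v) (Reg rN))))) (?I 0)"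
    unfolding For_def .
  then show ?thesis
  proof (rule tri_conseq)
    have "2 + ((N - lo) * (1 + exp_time (Bin Less (Reg v) (Reg rN)) + (C * N ^ j + 4)) + (1 + exp_time (Bin Less (Reg v) (Reg rN))))
        = (N - lo) * (C * N ^ j + 8) + 6" by simp
    also have "\<dots> \<le> N * (C * N ^ j + 8) + N * 6"
      by (intro add_mono mult_le_mono) simp_all
    also have "\<dots> = C * N ^ Suc j + 14 * N"
      unfolding power_Suc add_mult_distrib2 by (simp only: mult_ac)
    also have "\<dots> \<le> C * N ^ Suc j + 14 * N ^ Suc j"
      by (intro add_mono mult_le_mono order.refl self_le_power) simp_all
    finally show "2 + ((N - lo) * (1 + exp_time (Bin Less (Reg v) (Reg rN)) + (C * N ^ j + 4)) + (1 + exp_time (Bin Less (Reg v) (Reg rN)))) \<le> (C + 14) * N ^ Suc j"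
      by (simp only: add_mult_distrib)
    show "I N s" if "?I 0 s" for s using that by simp
  qed
qed

section \<open>Linked lists on the heap\<close>

definition base :: "state \<Rightarrow> bool" where
  "base s \<longleftrightarrow> fst s 0 = n \<and> fst s rN = N \<and> fst s rZ = null_addr n \<and> fst s rT = 2 * n + 1 \<and>
     null_addr n + 3 \<le> fst s rH \<and> (\<forall>x < n. snd s x = S ! x) \<and> snd s (null_addr n) = 0"

text \<open>All nodes lie between \<open>null_addr n\<close> and the heap end, so neither writes to
  the table below nor pushes at \<open>rH\<close> can damage a list.\<close>

primrec lst :: "state \<Rightarrow> nat \<Rightarrow> nat list \<Rightarrow> bool" where
  "lst s p [] = (p = null_addr n \<and> snd s p = 0 \<and> p < fst s rH)"
| "lst s p (x # xs) = (null_addr n < p \<and> p + 2 < fst s rH \<and> snd s p = Suc (length xs) \<and>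
     snd s (p + 1) = x \<and> lst s (snd s (p + 2)) xs)"

text \<open>\<open>D\<close> contains the allocated cells that may change.\<close>

definition upd :: "nat set \<Rightarrow> state \<Rightarrow> state \<Rightarrow> bool" where
  "upd D s s' \<longleftrightarrow> (\<forall>r. r \<notin> {rH, rP, rQ, rX} \<longrightarrow> fst s' r = fst s r) \<and>
     (\<forall>x < fst s rH. x \<notin> D \<longrightarrow> snd s' x = snd s x) \<and> fst s rH \<le> fst s' rH"

lemma upd_refl [simp]: "upd D s s"
  by (simp add: upd_def)

lemma upd_trans: "upd D s s' \<Longrightarrow> upd D s' s'' \<Longrightarrow> upd D s s''"
  by (simp add: upd_def)

lemma upd_mono: "upd D s s' \<Longrightarrow> D \<subseteq> D' \<Longrightarrow> upd D' s s'"
  by (auto simp: upd_def)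

lemma upd_reg: "upd D s s' \<Longrightarrow> r \<notin> {rH, rP, rQ, rX} \<Longrightarrow> fst s' r = fst s r"
  by (simp add: upd_def)

lemma upd_mem: "upd D s s' \<Longrightarrow> base s \<Longrightarrow> x < null_addr n \<Longrightarrow> x \<notin> D \<Longrightarrow> snd s' x = snd s x"
  by (simp add: upd_def base_def)

lemma upd_base:
  assumes "upd D s s'" "base s" "D \<inter> {..<n} = {}" "D \<subseteq> {..<null_addr n}"
  shows "base s'"
proof -
  have "snd s' x = snd s x" if "x < n \<or> x = null_addr n" for x
  proof -
    have "x \<notin> D" using assms(3,4) that by blast
    moreover have "x < fst s rH" using that assms(2) less_null_addr[of x n] unfolding base_def by linarith
    ultimately show ?thesis using assms(1) by (simp add: upd_def)
  qed
  with assms(1,2) show ?thesis by (auto simp: upd_def base_def)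
qed

lemma base_reg:
  "r \<notin> {0, rN, rH, rZ, rT} \<Longrightarrow> base (f(r := y), m) \<longleftrightarrow> base (f, m)"
  by (auto simp: base_def)

lemma lst_frame:
  assumes "lst s p xs" "fst s rH \<le> fst s' rH" "\<And>x. null_addr n \<le> x \<Longrightarrow> x < fst s rH \<Longrightarrow> snd s' x = snd s x"
  shows "lst s' p xs"
  using assms by (induction xs arbitrary: p) auto

lemma lst_reg: "r \<noteq> rH \<Longrightarrow> lst (f(r := y), m) p xs \<longleftrightarrow> lst (f, m) p xs"
  by (induction xs arbitrary: p) auto

lemma upd_lst: "upd D s s' \<Longrightarrow> D \<subseteq> {..<null_addr n} \<Longrightarrow> lst s p xs \<Longrightarrow> lst s' p xs"
  by (erule lst_frame) (auto simp: upd_def subset_iff)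

lemma lst_length: "lst s p xs \<Longrightarrow> snd s p = length xs"
  by (cases xs) auto

lemma lst_less: "lst s p xs \<Longrightarrow> p < fst s rH"
  by (cases xs) auto

lemma base_null: "base s \<Longrightarrow> lst s (null_addr n) []"
  by (simp add: base_def)

lemma exp_val_best_at:
  assumes "base s" "exp_val w e s \<le> n"
  shows "exp_val w (best_at e) s = n + exp_val w e s"
  using assms le_4n_M[of "n + exp_val w e s"] by (simp add: best_at_def base_def)

lemma exp_val_lcs_at:
  assumes "fst s rT = 2 * n + 1" "fst s rN = N" "exp_val w e s = a" "exp_val w f s = b" "exp_val w g s = c"
    and "tcell n a b c \<le> M"
  shows "exp_val w (lcs_at e f g) s = tcell n a b c"
proof -
  \<comment> \<open>As \<open>N\<close> is positive, the intermediate values of this Horner scheme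
    never exceed the final address, whose bound thus excludes overflow throughout.\<close>
  have "(a * N + b) * N + c \<le> M" "a * N + b \<le> (a * N + b) * N"
    using assms(6) by (simp_all add: tcell_def)
  then have "a * N \<le> M" "a * N + b \<le> M" "(a * N + b) * N \<le> M" "(a * N + b) * N + c \<le> M"
    by linarith+
  moreover have "2 * n + 1 + ((a * N + b) * N + c) \<le> M" using assms(6) by (simp add: tcell_def)
  ultimately show ?thesis
    by (simp add: lcs_at_def assms tcell_def del: mult_Suc_right mult_Suc)
qed

section \<open>Pushing a letter and prepending a whole list\<close>

lemma run_push:
  assumes s: "base s" "lst s (fst s rP) ys" "length ys < M" "fst s rH + 3 \<le> M"
  defines "s' \<equiv> run w push s"
  shows "upd {} s s'" "lst s' (fst s' rP) (fst s rX # ys)" "fst s' rH = fst s rH + 3" "fst s' rQ = fst s rQ"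
proof -
  let ?H = "fst s rH"
  have "snd s (fst s rP) = length ys" "fst s rP < ?H" using s(2) by (auto dest: lst_length lst_less)
  then have s': "s' = ((fst s)(rP := ?H, rH := ?H + 3),
      (snd s)(?H := Suc (length ys), ?H + 1 := fst s rX, ?H + 2 := fst s rP))"
    using s(3,4) by (simp add: s'_def push_def fun_upd_twist)
  show u: "upd {} s s'" unfolding s' upd_def by simp
  show "fst s' rH = fst s rH + 3" "fst s' rQ = fst s rQ" by (simp_all add: s')
  have "lst s' (fst s rP) ys" using upd_lst[OF u _ s(2)] by simp
  then show "lst s' (fst s' rP) (fst s rX # ys)" using s(1) by (simp add: s' base_def)
qed

lemma upd_base_empty: "upd {} s s' \<Longrightarrow> base s \<Longrightarrow> base s'"
  by (rule upd_base) auto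

lemma run_prepend_body:
  assumes s: "base s" "lst s (fst s rQ) (x # xs)" "lst s (fst s rP) ys" "length ys < M" "fst s rH + 3 \<le> M"
  defines "s' \<equiv> run w prepend_body s"
  shows "upd {} s s'" "lst s' (fst s' rQ) xs" "lst s' (fst s' rP) (x # ys)" "fst s' rH = fst s rH + 3"
proof -
  let ?q = "fst s rQ"
  have q: "?q + 2 < fst s rH" "snd s (?q + 1) = x" "lst s (snd s (?q + 2)) xs" using s(2) by auto
  define s1 where "s1 = ((fst s)(rX := x), snd s)"
  have s1: "base s1" "lst s1 (fst s1 rP) ys" "fst s1 rH = fst s rH" "fst s1 rX = x" "upd {} s s1" "fst s1 rQ = ?q"
    using s by (simp_all add: s1_def base_reg lst_reg upd_def)
  define s2 where "s2 = run w push s1"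
  note s2 = run_push[OF s1(1,2), unfolded s1 s2_def[symmetric], OF s(4,5)]
  have "upd {} s s2" using s1 s2 upd_trans by blast
  then have m: "snd s2 (?q + 2) = snd s (?q + 2)" using q by (simp add: upd_def)
  have s': "s' = ((fst s2)(rQ := snd s (?q + 2)), snd s2)"
    using q s(5) s2(3,4) s1(6) m by (simp add: s'_def prepend_body_def flip: s1_def s2_def)
  show "upd {} s s'" using \<open>upd {} s s2\<close> by (simp add: s' upd_def)
  show "lst s' (fst s' rQ) xs" using upd_lst[OF \<open>upd {} s s2\<close> _ q(3)] by (simp add: s' lst_reg)
  show "lst s' (fst s' rP) (x # ys)" using s2(2) by (simp add: s' lst_reg)
  show "fst s' rH = fst s rH + 3" using s2(3) by (simp add: s')
qed

text \<open>This is reversal with an accumulator: with \<open>us\<close> still to be moved and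
  \<open>vs\<close> already built, \<open>rev us @ vs\<close> is constant. A round costs 32 for the
  body and 4 for the test.\<close>

lemma tri_prepend:
  assumes "length xs + length ys \<le> M"
  shows "tri (\<lambda>s. base s \<and> upd {} s0 s \<and> lst s (fst s rQ) xs \<and> lst s (fst s rP) ys)
    prepend (length xs * 36 + 4) (\<lambda>s. base s \<and> upd {} s0 s \<and> lst s (fst s rP) (rev xs @ ys))"
proof -
  let ?I = "\<lambda>k s. base s \<and> upd {} s0 s \<and> (\<exists>us vs. lst s (fst s rQ) us \<and> lst s (fst s rP) vs \<and>
      length us = k \<and> rev us @ vs = rev xs @ ys)"
  have "tri (?I (Suc k)) prepend_body 32 (?I k)" for k
  proof (rule tri_straight)
    fix s assume s: "?I (Suc k) s" and H: "fst s rH + 32 \<le> M"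
    then obtain u us vs where uv: "lst s (fst s rQ) (u # us)" "lst s (fst s rP) vs" "length us = k"
      "rev us @ u # vs = rev xs @ ys" by (auto simp: length_Suc_conv)
    have l: "length vs < M" using arg_cong[OF uv(4), of length] assms by simp
    let ?s = "run w prepend_body s"
    note b = run_prepend_body[OF _ uv(1,2) l]
    have "upd {} s ?s" "lst ?s (fst ?s rQ) us" "lst ?s (fst ?s rP) (u # vs)" "fst ?s rH = fst s rH + 3"
      using b s H by simp_all
    moreover from this(1) s have "base ?s" "upd {} s0 ?s" using upd_base_empty upd_trans by blast+
    ultimately show "fst ?s rH \<le> fst s rH + 32 \<and> ?I k ?s" using uv by force
  qed (simp_all add: prepend_body_def push_def)
  moreover have "exp_val w (Bin Less (Reg rZ) (Reg rQ)) s \<noteq> 0 \<longleftrightarrow> k > 0" if "?I k s" for k s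
    using that by (cases k) (auto simp: base_def length_Suc_conv)
  ultimately have "tri (?I (length xs)) prepend
     (length xs * (1 + exp_time (Bin Less (Reg rZ) (Reg rQ)) + 32) + (1 + exp_time (Bin Less (Reg rZ) (Reg rQ)))) (?I 0)"
    unfolding prepend_def by (rule tri_While)
  then show ?thesis by (rule tri_conseq) auto
qed

section \<open>Tables of common subsequences\<close>

text \<open>The string is stored as \<open>rev u\<close> because the recursion extends
  \<open>u\<close> at its end, which becomes a single push at the front of the list.\<close>

definition cell_ok :: "nat \<Rightarrow> nat \<Rightarrow> nat \<Rightarrow> state \<Rightarrow> nat \<Rightarrow> nat \<Rightarrow> nat \<Rightarrow> bool" where
  "cell_ok i k l s a b c \<longleftrightarrow> (\<exists>u. lst s (snd s (tcell n a b c)) (rev u) \<and>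
     lcs3 (slice S i a) (slice S k b) (slice S l c) u)"

lemma tcell_le_M: "a \<le> n \<Longrightarrow> b \<le> n \<Longrightarrow> c \<le> n \<Longrightarrow> tcell n a b c \<le> M"
  using tcell_less_null[of a n b c] M_ge by linarith

lemma run_take_longer:
  assumes "exp_val w e s = x"
  shows "run w (take_longer e) s = ((fst s)(rP := (if snd s (fst s rP) < snd s (snd s x) then snd s x else fst s rP)), snd s)"
  by (simp add: take_longer_def assms)

text \<open>A cell needs at most one new node: it takes over a pointer, or it puts the common last
  letter in front of the list of the diagonal neighbour. Hence the heap grows by at most 3.\<close>

lemma run_fill_cell:
  assumes s: "base s" "fst s rI = i" "fst s rK = k" "fst s rL = l" "fst s rA = a" "fst s rB = b" "fst s rC = c"
    and le: "i \<le> a" "a \<le> n" "k \<le> b" "b \<le> n" "l \<le> c" "c \<le> n"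
    and prev: "i < a \<and> k < b \<and> l < c \<Longrightarrow> cell_ok i k l s (a - 1) (b - 1) (c - 1) \<and> cell_ok i k l s (a - 1) b c \<and>
       cell_ok i k l s a (b - 1) c \<and> cell_ok i k l s a b (c - 1)"
    and H: "fst s rH + 3 \<le> M"
  defines "s' \<equiv> run w fill_cell s"
  shows "upd {tcell n a b c} s s' \<and> fst s' rH \<le> fst s rH + 3 \<and> cell_ok i k l s' a b c"
proof -
  let ?t = "lcs_at (Reg rA) (Reg rB) (Reg rC)"
  have regs: "fst s1 rI = i" "fst s1 rK = k" "fst s1 rL = l" "fst s1 rA = a" "fst s1 rB = b" "fst s1 rC = c"
     "fst s1 rT = 2 * n + 1" "fst s1 rN = N" "base s1" if "upd {} s s1" for s1
    using that s upd_base_empty[OF that s(1)] by (auto simp: upd_def base_def)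
  \<comment> \<open>The common end of all cases: lists do not occupy table cells, so storing the
    pointer leaves the list for \<open>u\<close> intact.\<close>
  have store: "upd {tcell n a b c} s s2 \<and> cell_ok i k l s2 a b c"
    if "upd {} s s1" "lst s1 p (rev u)" "lcs3 (slice S i a) (slice S k b) (slice S l c) u"
      and s2: "s2 = (fst s1, (snd s1)(tcell n a b c := p))" for s1 s2 p u
  proof -
    have 1: "upd {tcell n a b c} s1 s2" by (simp add: s2 upd_def)
    with upd_mono[OF that(1), of "{tcell n a b c}"] have "upd {tcell n a b c} s s2"
      using upd_trans by blast
    moreover have "lst s2 p (rev u)"
      using upd_lst[OF 1 _ that(2)] tcell_less_null le by simp
    ultimately show ?thesis using that(3) by (auto simp: cell_ok_def s2)
  qed
  have nM: "n \<le> M" using le_4n_M[of n] by simp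
  show ?thesis
  proof (cases "i < a \<and> k < b \<and> l < c")
    case False
    have "s' = (fst s, (snd s)(tcell n a b c := null_addr n))"
      using False s le exp_val_lcs_at[of s "Reg rA" a "Reg rB" b "Reg rC" c] tcell_le_M[of a b c] regs[OF upd_refl]
      by (auto simp: s'_def fill_cell_def base_def)
    moreover have "lcs3 (slice S i a) (slice S k b) (slice S l c) []"
      using False le by (intro lcs3_Nil) (auto simp: slice_def)
    ultimately show ?thesis using store[OF upd_refl, of "null_addr n" "[]" s'] base_null[OF s(1)] by simp
  next
    case True
    then have pos: "0 < a" "0 < b" "0 < c" and leM: "a \<le> M" "b \<le> M" "c \<le> M" using le nM by auto
    have letters: "exp_val w (Load (dec (Reg rA))) s = S ! (a - 1)"
      "exp_val w (Load (dec (Reg rB))) s = S ! (b - 1)"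
      "exp_val w (Load (dec (Reg rC))) s = S ! (c - 1)"
      using s pos leM le by (auto simp: base_def)
    have adr: "exp_val w (lcs_at (dec (Reg rA)) (dec (Reg rB)) (dec (Reg rC))) s1 = tcell n (a - 1) (b - 1) (c - 1)"
      "exp_val w (lcs_at (dec (Reg rA)) (Reg rB) (Reg rC)) s1 = tcell n (a - 1) b c"
      "exp_val w (lcs_at (Reg rA) (dec (Reg rB)) (Reg rC)) s1 = tcell n a (b - 1) c"
      "exp_val w (lcs_at (Reg rA) (Reg rB) (dec (Reg rC))) s1 = tcell n a b (c - 1)"
      "exp_val w ?t s1 = tcell n a b c"
      if "upd {} s s1" for s1
      using regs[OF that] pos leM le by (auto intro!: exp_val_lcs_at tcell_le_M)
    have slices: "slice S i a = slice S i (a - 1) @ [S ! (a - 1)]" "slice S k b = slice S k (b - 1) @ [S ! (b - 1)]"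
      "slice S l c = slice S l (c - 1) @ [S ! (c - 1)]"
      using True le by (blast intro: slice_snoc)+
    have guard: "exp_val w (Bin Times (Bin Less (Reg rI) (Reg rA)) (Bin Times (Bin Less (Reg rK) (Reg rB)) (Bin Less (Reg rL) (Reg rC)))) s \<noteq> 0"
      using True s by simp
    have guard2: "exp_val w (Bin Times (Bin Equal (Load (dec (Reg rA))) (Load (dec (Reg rB))))
        (Bin Equal (Load (dec (Reg rB))) (Load (dec (Reg rC))))) s \<noteq> 0 \<longleftrightarrow>
        S ! (a - 1) = S ! (b - 1) \<and> S ! (b - 1) = S ! (c - 1)"
      using letters by (auto simp del: exp_val.simps(3))
    show ?thesis
    proof (cases "S ! (a - 1) = S ! (b - 1) \<and> S ! (b - 1) = S ! (c - 1)")
      case eq: True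
      obtain u where u: "lst s (snd s (tcell n (a - 1) (b - 1) (c - 1))) (rev u)"
        "lcs3 (slice S i (a - 1)) (slice S k (b - 1)) (slice S l (c - 1)) u"
        using prev[OF True] by (auto simp: cell_ok_def)
      have "length u \<le> length (slice S i (a - 1))" using u(2) by (auto simp: lcs3_iff dest: list_emb_length)
      then have lu: "length (rev u) < M" using le pos nM by (simp add: slice_def)
      define s1 where "s1 = ((fst s)(rX := S ! (a - 1), rP := snd s (tcell n (a - 1) (b - 1) (c - 1))), snd s)"
      have s1: "upd {} s s1" "base s1" "fst s1 rH = fst s rH" "fst s1 rX = S ! (a - 1)"
        using s by (simp_all add: s1_def upd_def base_reg)
      have "lst s1 (fst s1 rP) (rev u)" using u(1) by (simp add: s1_def lst_reg)
      note p = run_push[OF s1(2) this lu, unfolded s1(3,4), OF H]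
      have u2: "upd {} s (run w push s1)" using s1(1) p(1) upd_trans by blast
      have "upd {} s ((fst s)(rX := S ! (a - 1)), snd s)" by (simp add: upd_def)
      from adr(1)[OF this] have load: "exp_val w (Load (lcs_at (dec (Reg rA)) (dec (Reg rB)) (dec (Reg rC))))
          ((fst s)(rX := S ! (a - 1)), snd s) = snd s (tcell n (a - 1) (b - 1) (c - 1))" by simp
      have guard3: "exp_val w (Bin Times (Bin Equal (Load (dec (Reg rA))) (Load (dec (Reg rB))))
          (Bin Equal (Load (dec (Reg rB))) (Load (dec (Reg rC))))) s \<noteq> 0"
        using eq guard2 by blast
      have "s' = (fst (run w push s1), (snd (run w push s1))(tcell n a b c := fst (run w push s1) rP))"
        using guard guard3 letters(1) load adr(5)[OF u2]
        by (simp add: s'_def fill_cell_def s1_def del: exp_val.simps(3,4))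
      moreover have "lcs3 (slice S i a) (slice S k b) (slice S l c) (u @ [S ! (a - 1)])"
        using lcs3_snoc_eq[OF u(2), of "S ! (a - 1)"] eq slices by simp
      ultimately show ?thesis using store[OF u2, of "fst (run w push s1) rP" "u @ [S ! (a - 1)]" s'] p(2,3) by simp
    next
      case neq: False
      obtain u1 where u1: "lst s (snd s (tcell n (a - 1) b c)) (rev u1)"
        "lcs3 (slice S i (a - 1)) (slice S k b) (slice S l c) u1"
        using prev[OF True] by (auto simp: cell_ok_def)
      obtain u2 where u2: "lst s (snd s (tcell n a (b - 1) c)) (rev u2)"
        "lcs3 (slice S i a) (slice S k (b - 1)) (slice S l c) u2"
        using prev[OF True] by (auto simp: cell_ok_def)
      obtain u3 where u3: "lst s (snd s (tcell n a b (c - 1))) (rev u3)"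
        "lcs3 (slice S i a) (slice S k b) (slice S l (c - 1)) u3"
        using prev[OF True] by (auto simp: cell_ok_def)
      note len = lst_length[OF u1(1)] lst_length[OF u2(1)] lst_length[OF u3(1)]
      define s1 where "s1 = ((fst s)(rP := snd s (tcell n (a - 1) b c)), snd s)"
      define s2 where "s2 = run w (take_longer (lcs_at (Reg rA) (dec (Reg rB)) (Reg rC))) s1"
      define s3 where "s3 = run w (take_longer (lcs_at (Reg rA) (Reg rB) (dec (Reg rC)))) s2"
      have s1: "upd {} s s1" by (simp add: s1_def upd_def)
      note r2 = run_take_longer[OF adr(3)[OF s1], folded s2_def]
      have s2: "upd {} s s2" by (simp add: r2 s1_def upd_def)
      note r3 = run_take_longer[OF adr(4)[OF s2], folded s3_def]
      have s3: "upd {} s s3" by (simp add: r2 r3 s1_def upd_def)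
      have guard3: "exp_val w (Bin Times (Bin Equal (Load (dec (Reg rA))) (Load (dec (Reg rB))))
          (Bin Equal (Load (dec (Reg rB))) (Load (dec (Reg rC))))) s = 0"
        using neq guard2 by blast
      have load: "exp_val w (Load (lcs_at (dec (Reg rA)) (Reg rB) (Reg rC))) s = snd s (tcell n (a - 1) b c)"
        using adr(2)[OF upd_refl] by simp
      have sn: "snd s3 = snd s" and fH: "fst s3 rH = fst s rH" by (simp_all add: r2 r3 s1_def)
      have "\<exists>u \<in> {u1, u2, u3}. lst s (fst s3 rP) (rev u) \<and> length u1 \<le> length u \<and> length u2 \<le> length u \<and> length u3 \<le> length u"
        using u1(1) u2(1) u3(1) len by (simp add: r3 r2 s1_def)
      then obtain u where u: "u \<in> {u1, u2, u3}" "lst s (fst s3 rP) (rev u)"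
        "length u1 \<le> length u" "length u2 \<le> length u" "length u3 \<le> length u" by blast
      have "lcs3 (slice S i a) (slice S k b) (slice S l c) u"
        unfolding slices
        by (rule lcs3_snoc_neq[OF neq u1(2)[unfolded slices] u2(2)[unfolded slices] u3(2)[unfolded slices] u(1,3-5)])
      moreover have "lst s3 (fst s3 rP) (rev u)" using upd_lst[OF s3 _ u(2)] by simp
      moreover have "s' = (fst s3, (snd s3)(tcell n a b c := fst s3 rP))"
        using guard guard3 load adr(5)[OF s3]
        by (simp add: s'_def fill_cell_def s1_def s2_def s3_def del: exp_val.simps(3,4))
      ultimately show ?thesis using store[OF s3, of "fst s3 rP" u s'] fH by simp
    qed
  qed
qed

section \<open>Extending optimal suffixes\<close>

text \<open>Fixing one initial state at a time turns it into a parameter that the postcondition may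
  mention.\<close>

lemma tri_state: "(\<And>s0. P s0 \<Longrightarrow> tri (\<lambda>s. s = s0) c \<tau> Q) \<Longrightarrow> tri P c \<tau> Q"
  by (auto simp: tri_def)

lemma tri_prepend_copies:
  assumes s0: "base s0" "lst s0 (snd s0 x) (rev u)" "x < null_addr n"
    and e: "\<And>s. base s \<Longrightarrow> upd {} s0 s \<Longrightarrow> exp_val w e s = x"
    and len: "d * length u + length y \<le> M"
  shows "tri (\<lambda>s. base s \<and> upd {} s0 s \<and> lst s (fst s rP) y) (prepend_copies e d)
     (d * (length u * 36 + 6 + exp_time e) + 1)
     (\<lambda>s. base s \<and> upd {} s0 s \<and> lst s (fst s rP) (word_power u d @ y))"
  using len
proof (induction d)
  case 0
  show ?case by (rule tri_straight) simp_all
next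
  case (Suc d)
  let ?y = "word_power u d @ y"
  let ?Q = "\<lambda>s. base s \<and> upd {} s0 s \<and> lst s (fst s rQ) (rev u) \<and> lst s (fst s rP) ?y"
  have "tri (\<lambda>s. base s \<and> upd {} s0 s \<and> lst s (fst s rP) ?y) (Assign rQ (Load e)) (2 + exp_time e) ?Q"
  proof (rule tri_straight)
    fix s assume s: "base s \<and> upd {} s0 s \<and> lst s (fst s rP) ?y"
    then have "lst s (snd s x) (rev u)"
      using upd_lst[of "{}" s0 s, OF _ _ s0(2)] upd_mem[of "{}" s0 s, OF _ s0(1,3)] by simp
    then show "fst (run w (Assign rQ (Load e)) s) rH \<le> fst s rH + (2 + exp_time e) \<and> ?Q (run w (Assign rQ (Load e)) s)"
      using s e[of s] by (simp add: base_reg lst_reg upd_def)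
  qed simp_all
  moreover have "tri ?Q prepend (length u * 36 + 4) (\<lambda>s. base s \<and> upd {} s0 s \<and> lst s (fst s rP) (u @ ?y))"
    using tri_prepend[of "rev u" ?y s0] Suc.prems by simp
  ultimately have "tri (\<lambda>s. base s \<and> upd {} s0 s \<and> lst s (fst s rP) ?y) (Seq (Assign rQ (Load e)) prepend)
      (2 + exp_time e + (length u * 36 + 4)) (\<lambda>s. base s \<and> upd {} s0 s \<and> lst s (fst s rP) (u @ ?y))"
    by (rule tri_Seq)
  then have "tri (\<lambda>s. base s \<and> upd {} s0 s \<and> lst s (fst s rP) y) (prepend_copies e (Suc d))
     (d * (length u * 36 + 6 + exp_time e) + 1 + (2 + exp_time e + (length u * 36 + 4)))
     (\<lambda>s. base s \<and> upd {} s0 s \<and> lst s (fst s rP) (u @ ?y))"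
    unfolding prepend_copies.simps using Suc.prems by (intro tri_Seq[OF Suc.IH]) simp_all
  then show ?case by (rule tri_conseq) (simp_all add: word_power_Suc)
qed

text \<open>\<open>\<Phi>\<close> is an upward closed condition collecting the lower bounds on the length of the current best
  string for the suffix from \<open>i\<close>; that string may be used as its own tail in candidates with \<open>j = i\<close>,
  which is harmless.\<close>

definition best_inv :: "nat \<Rightarrow> (nat \<Rightarrow> bool) \<Rightarrow> state \<Rightarrow> bool" where
  "best_inv i \<Phi> s \<longleftrightarrow> base s \<and> fst s rI = i \<and>
     (\<forall>j. i < j \<longrightarrow> j \<le> n \<longrightarrow> (\<exists>y. lst s (snd s (n + j)) y \<and> opt_suffix S j y)) \<and>
     (\<exists>y. lst s (snd s (n + i)) y \<and> pow_concat y \<and> subseq y (drop i S) \<and> \<Phi> (length y))"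

lemma best_inv_upd:
  assumes "best_inv i \<Phi> s" "upd D s s'" "D \<inter> {..2 * n} = {}" "D \<subseteq> {..<null_addr n}" "i \<le> n"
  shows "best_inv i \<Phi> s'"
proof -
  have b: "base s" using assms(1) by (simp add: best_inv_def)
  then have "base s'" using upd_base[OF assms(2)] assms(3,4) by fastforce
  moreover have "snd s' (n + j) = snd s (n + j)" if "j \<le> n" for j
  proof (rule upd_mem[OF assms(2) b])
    show "n + j < null_addr n" using that less_null_addr[of "n + j" n] by simp
    have "n + j \<in> {..2 * n}" using that by simp
    with assms(3) show "n + j \<notin> D" by blast
  qed
  moreover have "fst s' rI = fst s rI" using assms(2) by (simp add: upd_def)
  ultimately show ?thesis
    using assms(1,5) upd_lst[OF assms(2,4)] unfolding best_inv_def by (simp, blast)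
qed

text \<open>Afterwards the stored string is at least as long as both the old one and the candidate.
  Upward closure preserves the old bounds, and for \<open>i < j\<close> the optimality of the
  candidate's tail yields the new bound for every competing tail.\<close>

lemma tri_try_power:
  assumes inv: "best_inv i \<Phi> s0" and j: "fst s0 rJ = j" "i \<le> j" "j \<le> n"
    and mono: "\<And>m m'. \<Phi> m \<Longrightarrow> m \<le> m' \<Longrightarrow> \<Phi> m'"
    and u: "lst s0 (snd s0 x) (rev u)" "x < null_addr n" "length u \<le> n"
    and e: "\<And>s. base s \<Longrightarrow> upd {} s0 s \<Longrightarrow> exp_val w e s = x" "exp_time e \<le> 20"
    and d: "d \<in> {2, 3}"
    and sound: "\<And>y. subseq y (drop j S) \<Longrightarrow> subseq (word_power u d @ y) (drop i S)"
  shows "tri (\<lambda>s. s = s0) (try_power e d) (300 * N ^ 1) (\<lambda>s. upd {n + i} s0 s \<and>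
    best_inv i (\<lambda>m. \<Phi> m \<and> (i < j \<longrightarrow> (\<forall>y. pow_concat y \<longrightarrow> subseq y (drop j S) \<longrightarrow> d * length u + length y \<le> m))) s)"
proof -
  have s0: "base s0" "fst s0 rI = i" using inv by (simp_all add: best_inv_def)
  obtain y where y: "lst s0 (snd s0 (n + j)) y" "pow_concat y" "subseq y (drop j S)"
      and opt: "i < j \<longrightarrow> opt_suffix S j y"
  proof (cases "i = j")
    case True
    then show thesis using that inv unfolding best_inv_def by blast
  next
    case False
    then obtain y where "lst s0 (snd s0 (n + j)) y" "opt_suffix S j y"
      using inv j unfolding best_inv_def by (metis le_neq_implies_less)
    then show thesis using that unfolding opt_suffix_iff by blast
  qed
  obtain z where z: "lst s0 (snd s0 (n + i)) z" "pow_concat z" "subseq z (drop i S)" "\<Phi> (length z)"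
    using inv by (auto simp: best_inv_def)
  let ?v = "word_power u d @ y"
  let ?Q1 = "\<lambda>s. base s \<and> upd {} s0 s \<and> lst s (fst s rP) y"
  let ?Q2 = "\<lambda>s. base s \<and> upd {} s0 s \<and> lst s (fst s rP) ?v"
  let ?\<Psi> = "\<lambda>m. \<Phi> m \<and> (i < j \<longrightarrow> (\<forall>y. pow_concat y \<longrightarrow> subseq y (drop j S) \<longrightarrow> d * length u + length y \<le> m))"
  let ?upd = "If (Bin Less (Load (Load (best_at (Reg rI)))) (Load (Reg rP))) (Store (best_at (Reg rI)) (Reg rP)) Skip"
  have "tri (\<lambda>s. s = s0) (Assign rP (Load (best_at (Reg rJ)))) 5 ?Q1"
  proof (rule tri_straight)
    fix s assume "s = s0"
    then show "fst (run w (Assign rP (Load (best_at (Reg rJ)))) s) rH \<le> fst s rH + 5 \<and>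
        ?Q1 (run w (Assign rP (Load (best_at (Reg rJ)))) s)"
      using s0 y(1) j by (simp add: exp_val_best_at base_reg lst_reg upd_def)
  qed simp_all
  moreover have "tri ?Q1 (prepend_copies e d) (d * (length u * 36 + 6 + exp_time e) + 1) ?Q2"
  proof (rule tri_prepend_copies[OF s0(1) u(1,2) e(1)])
    have "length y \<le> n" using list_emb_length[OF y(3)] by simp
    moreover have "d * length u \<le> 3 * n" using d u(3) by auto
    ultimately show "d * length u + length y \<le> M" using le_4n_M by simp
  qed
  moreover have "tri ?Q2 ?upd 20 (\<lambda>s. upd {n + i} s0 s \<and> best_inv i ?\<Psi> s)"
  proof (rule tri_straight)
    fix s assume s: "?Q2 s"
    have ad: "exp_val w (best_at (Reg rI)) s = n + i"
      using s s0 j by (simp add: exp_val_best_at upd_def)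
    have low: "n + i < null_addr n" "{n + i} \<subseteq> {..<null_addr n}" using j less_null_addr[of "n + i" n] by auto
    have old: "snd s (n + i') = snd s0 (n + i')" if "i' \<le> n" for i'
      using s upd_mem[of "{}" s0 s "n + i'"] s0(1) less_null_addr[of "n + i'" n] that by simp
    have zs: "lst s (snd s (n + i)) z" using upd_lst[of "{}" s0 s, OF _ _ z(1)] s old[of i] j by simp
    have guard: "exp_val w (Bin Less (Load (Load (best_at (Reg rI)))) (Load (Reg rP))) s \<noteq> 0 \<longleftrightarrow> length z < length ?v"
      using lst_length[OF zs] s lst_length[of s "fst s rP" ?v] ad by simp
    define p where "p = (if length z < length ?v then fst s rP else snd s (n + i))"
    define b where "b = (if length z < length ?v then ?v else z)"
    define s' where "s' = (fst s, (snd s)(n + i := p))"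
    have run: "run w ?upd s = s'"
      using guard ad unfolding run.simps(4) by (simp add: p_def s'_def)
    have upd1: "upd {n + i} s s'" by (simp add: s'_def upd_def)
    have "upd {n + i} s0 s" using s upd_mono by blast
    from upd_trans[OF this upd1] have upd0: "upd {n + i} s0 s'" .
    have "lst s p b" using s zs by (simp add: p_def b_def)
    from upd_lst[OF upd1 low(2) this] have "lst s' (snd s' (n + i)) b" by (simp add: s'_def)
    moreover have "pow_concat b" using z(2) pow_concat_append[OF y(2), of d u] d by (auto simp: b_def)
    moreover have "subseq b (drop i S)" using z(3) sound[OF y(3)] by (simp add: b_def)
    moreover have "length z \<le> length b" "length ?v \<le> length b" by (auto simp: b_def)
    then have "?\<Psi> (length b)" using mono[OF z(4)] opt by (auto simp: opt_suffix_iff)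
    moreover have "base s'" using upd_base[OF upd1] s low by auto
    moreover have "\<exists>y. lst s' (snd s' (n + j')) y \<and> opt_suffix S j' y" if j': "i < j'" "j' \<le> n" for j'
    proof -
      obtain y' where "lst s0 (snd s0 (n + j')) y'" "opt_suffix S j' y'"
        using inv j' unfolding best_inv_def by blast
      moreover have "snd s' (n + j') = snd s0 (n + j')" using j' old by (simp add: s'_def)
      ultimately show ?thesis using upd_lst[OF upd0 low(2)] by metis
    qed
    ultimately have "best_inv i ?\<Psi> s'" using upd_reg[OF upd0, of rI] s0 unfolding best_inv_def by auto
    with upd0 show "fst (run w ?upd s) rH \<le> fst s rH + 20 \<and> upd {n + i} s0 (run w ?upd s) \<and> best_inv i ?\<Psi> (run w ?upd s)"
      unfolding run by (simp add: s'_def)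
  qed simp_all
  ultimately have "tri (\<lambda>s. s = s0) (try_power e d) (5 + (d * (length u * 36 + 6 + exp_time e) + 1 + 20))
      (\<lambda>s. upd {n + i} s0 s \<and> best_inv i ?\<Psi> s)"
    unfolding try_power_def by (intro tri_Seq)
  then show ?thesis
  proof (rule tri_conseq)
    \<comment> \<open>Copying is linear in \<open>n\<close>: with \<open>d \<le> 3\<close> and
      \<open>length u \<le> n\<close> the total is at most \<open>108 * n + 104\<close>.\<close>
    have "d * (length u * 36 + 6 + exp_time e) \<le> 3 * (n * 36 + 6 + 20)"
      using d u(3) e(2) by (intro mult_le_mono add_mono) auto
    then show "5 + (d * (length u * 36 + 6 + exp_time e) + 1 + 20) \<le> 300 * N ^ 1" by simp
  qed auto
qed

section \<open>The nested loops\<close>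

lemma cell_ok_upd:
  assumes "upd D s s'" "D \<subseteq> {..<null_addr n}" "base s" "a \<le> n" "b \<le> n" "c \<le> n" "tcell n a b c \<notin> D"
    and "cell_ok i k l s a b c"
  shows "cell_ok i k l s' a b c"
  using assms(8) upd_mem[OF assms(1,3) tcell_less_null[OF assms(4-6)] assms(7)] upd_lst[OF assms(1,2)]
  unfolding cell_ok_def by metis

lemma cell_ok_reg: "r \<noteq> rH \<Longrightarrow> cell_ok i k l (f(r := y), m) a b c \<longleftrightarrow> cell_ok i k l (f, m) a b c"
  by (simp add: cell_ok_def lst_reg)

lemma best_inv_reg:
  "r \<notin> {0, rN, rH, rZ, rT, rI} \<Longrightarrow> best_inv i \<Phi> (f(r := y), m) \<longleftrightarrow> best_inv i \<Phi> (f, m)"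
  by (simp add: best_inv_def base_reg lst_reg)

lemma best_inv_mono: "best_inv i \<Phi> s \<Longrightarrow> (\<And>m. \<Phi> m \<Longrightarrow> \<Psi> m) \<Longrightarrow> best_inv i \<Psi> s"
  unfolding best_inv_def by blast

section \<open>Filling a table in lexicographic order\<close>

definition cells_before :: "nat \<Rightarrow> nat \<Rightarrow> nat \<Rightarrow> nat \<Rightarrow> nat \<Rightarrow> nat \<Rightarrow> state \<Rightarrow> bool" where
  "cells_before i k l a b c s \<longleftrightarrow> (\<forall>a' b' c'. i \<le> a' \<longrightarrow> a' \<le> n \<longrightarrow> k \<le> b' \<longrightarrow> b' \<le> n \<longrightarrow> l \<le> c' \<longrightarrow> c' \<le> n \<longrightarrow>
     a' < a \<or> a' = a \<and> b' < b \<or> a' = a \<and> b' = b \<and> c' < c \<longrightarrow> cell_ok i k l s a' b' c')"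

lemma cells_before_reg:
  "r \<noteq> rH \<Longrightarrow> cells_before i k l a b c (f(r := y), m) \<longleftrightarrow> cells_before i k l a b c (f, m)"
  by (simp add: cells_before_def cell_ok_reg)

text \<open>This performs the carries between the loops: as indices are at most \<open>n\<close>,
  having reached \<open>(a, b, N)\<close> amounts to \<open>(a, b + 1, l)\<close>, and
  \<open>(a, N, l)\<close> to \<open>(a + 1, k, l)\<close>.\<close>

lemma cells_before_mono:
  assumes "cells_before i k l a b c s"
    and "\<And>a' b' c'. b' \<le> n \<Longrightarrow> c' \<le> n \<Longrightarrow> k \<le> b' \<Longrightarrow> l \<le> c' \<Longrightarrow>
       a' < a2 \<or> a' = a2 \<and> b' < b2 \<or> a' = a2 \<and> b' = b2 \<and> c' < c2 \<Longrightarrow>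
       a' < a \<or> a' = a \<and> b' < b \<or> a' = a \<and> b' = b \<and> c' < c"
  shows "cells_before i k l a2 b2 c2 s"
  unfolding cells_before_def
  by (intro allI impI assms(1)[unfolded cells_before_def, rule_format] assms(2))

definition loop_inv :: "nat \<Rightarrow> nat \<Rightarrow> nat \<Rightarrow> (nat \<Rightarrow> bool) \<Rightarrow> state \<Rightarrow> bool" where
  "loop_inv i k l \<Phi> s \<longleftrightarrow> best_inv i \<Phi> s \<and> fst s rV = n - i \<and> fst s rK = k \<and> fst s rL = l"

lemma loop_inv_reg:
  "r \<notin> {0, rN, rH, rZ, rT, rI, rV, rK, rL} \<Longrightarrow> loop_inv i k l \<Phi> (f(r := y), m) \<longleftrightarrow> loop_inv i k l \<Phi> (f, m)"
  by (simp add: loop_inv_def best_inv_reg)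

lemma loop_inv_base: "loop_inv i k l \<Phi> s \<Longrightarrow> base s" and
  loop_inv_regs: "loop_inv i k l \<Phi> s \<Longrightarrow> fst s rN = N \<and> fst s rI = i \<and> fst s rK = k \<and> fst s rL = l \<and> fst s rT = 2 * n + 1"
  by (simp_all add: loop_inv_def best_inv_def base_def)

lemma tri_fill_cell:
  assumes "i \<le> k" "k \<le> l" "l \<le> n" "i \<le> a" "a \<le> n" "k \<le> b" "b \<le> n" "l \<le> c" "c \<le> n"
  shows "tri (\<lambda>s. (loop_inv i k l \<Phi> s \<and> cells_before i k l a b c s \<and> fst s rA = a \<and> fst s rB = b) \<and> fst s rC = c)
    fill_cell (400 * N ^ 0)
    (\<lambda>s. (loop_inv i k l \<Phi> s \<and> cells_before i k l a b (Suc c) s \<and> fst s rA = a \<and> fst s rB = b) \<and> fst s rC = c)"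
proof (rule tri_straight)
  fix s assume s: "(loop_inv i k l \<Phi> s \<and> cells_before i k l a b c s \<and> fst s rA = a \<and> fst s rB = b) \<and> fst s rC = c"
    and H: "fst s rH + 400 * N ^ 0 \<le> M"
  then have inv: "loop_inv i k l \<Phi> s" and cells: "cells_before i k l a b c s" by auto
  define s' where "s' = run w fill_cell s"
  \<comment> \<open>All four neighbours precede \<open>(a, b, c)\<close> lexicographically, and
    strictness of the three inequalities keeps them inside the table.\<close>
  have prev: "cell_ok i k l s (a - 1) (b - 1) (c - 1) \<and> cell_ok i k l s (a - 1) b c \<and>
       cell_ok i k l s a (b - 1) c \<and> cell_ok i k l s a b (c - 1)" if "i < a \<and> k < b \<and> l < c"
    using that assms by (intro conjI cells[unfolded cells_before_def, rule_format]) auto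
  have "upd {tcell n a b c} s s' \<and> fst s' rH \<le> fst s rH + 3 \<and> cell_ok i k l s' a b c"
    unfolding s'_def
    by (rule run_fill_cell) (use s loop_inv_base[OF inv] loop_inv_regs[OF inv] assms H prev in simp_all)
  then have u: "upd {tcell n a b c} s s'" and H': "fst s' rH \<le> fst s rH + 3" and ok: "cell_ok i k l s' a b c"
    by auto
  have low: "{tcell n a b c} \<subseteq> {..<null_addr n}" using tcell_less_null assms by simp
  have "loop_inv i k l \<Phi> s'"
  proof -
    have dis: "{tcell n a b c} \<inter> {..2 * n} = {}" using less_tcell[of "tcell n a b c" n a b c] by auto
    have "best_inv i \<Phi> s'"
      by (rule best_inv_upd[OF _ u dis low]) (use inv assms in \<open>simp_all add: loop_inv_def\<close>)
    then show ?thesis using inv upd_reg[OF u] by (simp add: loop_inv_def)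
  qed
  moreover have "cells_before i k l a b (Suc c) s'"
    unfolding cells_before_def
  proof (intro allI impI)
    fix a' b' c' assume le: "i \<le> a'" "a' \<le> n" "k \<le> b'" "b' \<le> n" "l \<le> c'" "c' \<le> n"
      and lt: "a' < a \<or> a' = a \<and> b' < b \<or> a' = a \<and> b' = b \<and> c' < Suc c"
    show "cell_ok i k l s' a' b' c'"
    proof (cases "(a', b', c') = (a, b, c)")
      case True
      with ok show ?thesis by simp
    next
      case False
      with le assms have "tcell n a' b' c' \<noteq> tcell n a b c" by (simp add: tcell_inject)
      moreover have "cell_ok i k l s a' b' c'"
        using cells[unfolded cells_before_def, rule_format, OF le] lt False by auto
      ultimately show ?thesis using cell_ok_upd[OF u low loop_inv_base[OF inv]] le by simp
    qed
  qed
  ultimately show "fst (run w fill_cell s) rH \<le> fst s rH + 400 * N ^ 0 \<and>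
      (loop_inv i k l \<Phi> (run w fill_cell s) \<and> cells_before i k l a b (Suc c) (run w fill_cell s) \<and>
       fst (run w fill_cell s) rA = a \<and> fst (run w fill_cell s) rB = b) \<and> fst (run w fill_cell s) rC = c"
    using H' s upd_reg[OF u] by (simp flip: s'_def)
qed (simp_all add: fill_cell_def push_def take_longer_def)

text \<open>Each of the three loops adds 14 to the bound 400 for a single cell, which gives
  442.\<close>

lemma tri_fill_table:
  assumes "i \<le> k" "k \<le> l" "l \<le> n"
  shows "tri (loop_inv i k l \<Phi>) fill_table (442 * N ^ 3)
    (\<lambda>s. loop_inv i k l \<Phi> s \<and> cells_before i k l N k l s)"
proof -
  let ?c = "\<lambda>a b c s. loop_inv i k l \<Phi> s \<and> cells_before i k l a b c s \<and> fst s rA = a \<and> fst s rB = b"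
  let ?b = "\<lambda>a b s. loop_inv i k l \<Phi> s \<and> cells_before i k l a b l s \<and> fst s rA = a"
  let ?a = "\<lambda>a s. loop_inv i k l \<Phi> s \<and> cells_before i k l a k l s"
  have c: "tri (?c a b l) (For rC (Reg rL) fill_cell) ((400 + 14) * N ^ Suc 0) (?c a b N)"
    if "i \<le> a" "a \<le> n" "k \<le> b" "b \<le> n" for a b
    by (rule tri_For[OF tri_fill_cell])
       (use that assms in \<open>auto simp: loop_inv_reg cells_before_reg dest: loop_inv_regs\<close>)
  have b: "tri (?b a k) (For rB (Reg rK) (For rC (Reg rL) fill_cell)) ((400 + 14 + 14) * N ^ Suc (Suc 0)) (?b a N)"
    if "i \<le> a" "a \<le> n" for a
  proof (rule tri_For)
    show "tri (\<lambda>s. ?b a b s \<and> fst s rB = b) (For rC (Reg rL) fill_cell) ((400 + 14) * N ^ Suc 0)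
        (\<lambda>s. ?b a (Suc b) s \<and> fst s rB = b)" if "k \<le> b" "b \<le> n" for b
      by (rule tri_conseq[OF c[OF \<open>i \<le> a\<close> \<open>a \<le> n\<close> that]]) (auto elim!: cells_before_mono)
  qed (use assms in \<open>auto simp: loop_inv_reg cells_before_reg dest: loop_inv_regs\<close>)
  have "tri (?a i) (For rA (Reg rI) (For rB (Reg rK) (For rC (Reg rL) fill_cell)))
      ((400 + 14 + 14 + 14) * N ^ Suc (Suc (Suc 0))) (?a N)"
  proof (rule tri_For)
    show "tri (\<lambda>s. ?a a s \<and> fst s rA = a) (For rB (Reg rK) (For rC (Reg rL) fill_cell))
        ((400 + 14 + 14) * N ^ Suc (Suc 0)) (\<lambda>s. ?a (Suc a) s \<and> fst s rA = a)" if "i \<le> a" "a \<le> n" for a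
      by (rule tri_conseq[OF b[OF that]]) (auto elim!: cells_before_mono)
  qed (use assms in \<open>auto simp: loop_inv_reg cells_before_reg dest: loop_inv_regs\<close>)
  then show ?thesis
    unfolding fill_table_def by (rule tri_conseq) (auto simp: cells_before_def eval_nat_numeral)
qed

section \<open>Trying all cut points for one suffix\<close>

lemma dominatesI:
  assumes "lcs3 (slice S i k) (slice S k l) (slice S l j) u" "lcs3 (slice S i k) (slice S k j) (slice S l j) v"
    and "i < j \<Longrightarrow> (\<forall>y. pow_concat y \<longrightarrow> subseq y (drop j S) \<longrightarrow> 3 * length u + length y \<le> m \<and> 2 * length v + length y \<le> m)"
  shows "dominates S m i k l j"
  unfolding dominates_def
proof (intro impI allI conjI)
  fix x y assume x: "i < j" "subseq x (slice S i k)" "subseq x (slice S l j)" "pow_concat y" "subseq y (drop j S)"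
  show "3 * length x + length y \<le> m" if "subseq x (slice S k l)"
  proof -
    \<comment> \<open>Only the length of the base matters, so the one longest common subsequence
      that was tried accounts for every other base.\<close>
    have "length x \<le> length u" using assms(1) x that by (simp add: lcs3_iff)
    with assms(3) x show ?thesis by fastforce
  qed
  show "2 * length x + length y \<le> m" if "subseq x (slice S k j)"
  proof -
    have "length x \<le> length v" using assms(2) x that by (simp add: lcs3_iff)
    with assms(3) x show ?thesis by fastforce
  qed
qed

lemma dominates_mono: "dominates S m i k l j \<Longrightarrow> m \<le> m' \<Longrightarrow> dominates S m' i k l j"
  unfolding dominates_def by (meson le_trans)

lemma subseq_slice_length: "k \<le> n \<Longrightarrow> subseq x (slice S i k) \<Longrightarrow> length x \<le> n"
  by (drule list_emb_length) (simp add: slice_def)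

text \<open>The table entry at cell \<open>n + i\<close> for the best string is the only allocated
  cell that changes. It lies below the table of common subsequences, so the strings \<open>u\<close>
  and \<open>v\<close> read from \<open>s0\<close> are still available for both trials.\<close>

lemma tri_try_ends_body:
  assumes le: "i \<le> k" "k \<le> l" "l \<le> j" "j \<le> n"
    and mono: "\<And>m m'. \<Phi> m \<Longrightarrow> m \<le> m' \<Longrightarrow> \<Phi> m'"
  shows "tri (\<lambda>s. (loop_inv i k l \<Phi> s \<and> cells_before i k l N k l s) \<and> fst s rJ = j)
    (Seq (try_power (lcs_at (Reg rK) (Reg rL) (Reg rJ)) 3) (try_power (lcs_at (Reg rK) (Reg rJ) (Reg rJ)) 2))
    (600 * N ^ 1)
    (\<lambda>s. (loop_inv i k l (\<lambda>m. \<Phi> m \<and> dominates S m i k l j) s \<and> cells_before i k l N k l s) \<and> fst s rJ = j)"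
proof (rule tri_state)
  fix s0 assume s0: "(loop_inv i k l \<Phi> s0 \<and> cells_before i k l N k l s0) \<and> fst s0 rJ = j"
  then have inv: "loop_inv i k l \<Phi> s0" and cells: "cells_before i k l N k l s0" and J: "fst s0 rJ = j" by auto
  note b0 = loop_inv_base[OF inv]
  have low: "{n + i} \<subseteq> {..<null_addr n}" using le less_null_addr[of "n + i" n] by simp
  have cell0: "cell_ok i k l s0 a b c" if "i \<le> a" "a \<le> n" "k \<le> b" "b \<le> n" "l \<le> c" "c \<le> n" for a b c
    using cells that unfolding cells_before_def by simp
  have cell: "cell_ok i k l s a b c" if "upd {n + i} s0 s" "i \<le> a" "a \<le> n" "k \<le> b" "b \<le> n" "l \<le> c" "c \<le> n" for s a b c
    using cell_ok_upd[OF that(1) low b0 _ _ _ _ cell0] that less_tcell[of "n + i" n a b c] le by force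
  have ad: "exp_val w (lcs_at (Reg rK) (Reg rL) (Reg rJ)) s = tcell n k l j"
    "exp_val w (lcs_at (Reg rK) (Reg rJ) (Reg rJ)) s = tcell n k j j" if "upd {n + i} s0 s" for s
    using loop_inv_regs[OF inv] J upd_reg[OF that] le by (auto intro!: exp_val_lcs_at tcell_le_M)
  obtain u where u: "lst s0 (snd s0 (tcell n k l j)) (rev u)" "lcs3 (slice S i k) (slice S k l) (slice S l j) u"
    using cell0[of k l j] le by (auto simp: cell_ok_def)
  obtain v where v: "lst s0 (snd s0 (tcell n k j j)) (rev v)" "lcs3 (slice S i k) (slice S k j) (slice S l j) v"
    using cell0[of k j j] le by (auto simp: cell_ok_def)
  let ?\<Phi> = "\<lambda>m. \<Phi> m \<and> (i < j \<longrightarrow> (\<forall>y. pow_concat y \<longrightarrow> subseq y (drop j S) \<longrightarrow> 3 * length u + length y \<le> m))"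
  let ?\<Psi> = "\<lambda>m. ?\<Phi> m \<and> (i < j \<longrightarrow> (\<forall>y. pow_concat y \<longrightarrow> subseq y (drop j S) \<longrightarrow> 2 * length v + length y \<le> m))"
  have "tri (\<lambda>s. s = s0) (try_power (lcs_at (Reg rK) (Reg rL) (Reg rJ)) 3) (300 * N ^ 1)
     (\<lambda>s. upd {n + i} s0 s \<and> best_inv i ?\<Phi> s)"
  proof (rule tri_try_power[OF _ J _ _ mono u(1)])
    show "best_inv i \<Phi> s0" using inv by (simp add: loop_inv_def)
    show "length u \<le> n" using u(2) le subseq_slice_length[of k u i] by (simp add: lcs3_iff)
    show "subseq (word_power u 3 @ y) (drop i S)" if "subseq y (drop j S)" for y
      using cube_subseq[OF le(1-3) _ _ _ that] u(2) by (simp add: lcs3_iff)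
    show "exp_val w (lcs_at (Reg rK) (Reg rL) (Reg rJ)) s = tcell n k l j" if "upd {} s0 s" for s
      using ad(1) upd_mono[OF that] by simp
  qed (use le tcell_less_null in simp_all)
  moreover have "tri (\<lambda>s. upd {n + i} s0 s \<and> best_inv i ?\<Phi> s) (try_power (lcs_at (Reg rK) (Reg rJ) (Reg rJ)) 2) (300 * N ^ 1)
     (\<lambda>s. upd {n + i} s0 s \<and> best_inv i ?\<Psi> s)"
  proof (rule tri_state)
    fix s1 assume s1: "upd {n + i} s0 s1 \<and> best_inv i ?\<Phi> s1"
    have "tri (\<lambda>s. s = s1) (try_power (lcs_at (Reg rK) (Reg rJ) (Reg rJ)) 2) (300 * N ^ 1)
     (\<lambda>s. upd {n + i} s1 s \<and> best_inv i ?\<Psi> s)"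
    proof (rule tri_try_power)
      show "best_inv i ?\<Phi> s1" using s1 by simp
      show "fst s1 rJ = j" using s1 upd_reg[of "{n + i}" s0 s1 rJ] J by simp
      show "?\<Phi> m'" if "?\<Phi> m" "m \<le> m'" for m m' using that mono by (auto intro: le_trans)
      have "snd s1 (tcell n k j j) = snd s0 (tcell n k j j)"
        using upd_mem[of "{n + i}" s0 s1, OF _ b0 tcell_less_null] s1 le less_tcell[of "n + i" n k j j] by force
      then show "lst s1 (snd s1 (tcell n k j j)) (rev v)"
        using upd_lst[of "{n + i}" s0 s1, OF _ low v(1)] s1 by simp
      show "length v \<le> n" using v(2) le subseq_slice_length[of k v i] by (simp add: lcs3_iff)
      show "subseq (word_power v 2 @ y) (drop i S)" if "subseq y (drop j S)" for y
        using square_subseq[OF le(1) _ _ _ that] v(2) le by (simp add: lcs3_iff)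
      show "exp_val w (lcs_at (Reg rK) (Reg rJ) (Reg rJ)) s = tcell n k j j" if "upd {} s1 s" for s
        using ad(2) upd_trans[of "{n + i}" s0 s1 s] upd_mono[OF that] s1 by simp
    qed (use le tcell_less_null in simp_all)
    then show "tri (\<lambda>s. s = s1) (try_power (lcs_at (Reg rK) (Reg rJ) (Reg rJ)) 2) (300 * N ^ 1)
     (\<lambda>s. upd {n + i} s0 s \<and> best_inv i ?\<Psi> s)"
      using s1 upd_trans by (elim tri_conseq) blast+
  qed
  ultimately have "tri (\<lambda>s. s = s0)
    (Seq (try_power (lcs_at (Reg rK) (Reg rL) (Reg rJ)) 3) (try_power (lcs_at (Reg rK) (Reg rJ) (Reg rJ)) 2))
    (300 * N ^ 1 + 300 * N ^ 1) (\<lambda>s. upd {n + i} s0 s \<and> best_inv i ?\<Psi> s)"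
    by (rule tri_Seq)
  then show "tri (\<lambda>s. s = s0)
    (Seq (try_power (lcs_at (Reg rK) (Reg rL) (Reg rJ)) 3) (try_power (lcs_at (Reg rK) (Reg rJ) (Reg rJ)) 2))
    (600 * N ^ 1)
    (\<lambda>s. (loop_inv i k l (\<lambda>m. \<Phi> m \<and> dominates S m i k l j) s \<and> cells_before i k l N k l s) \<and> fst s rJ = j)"
  proof (rule tri_conseq)
    fix s assume s: "upd {n + i} s0 s \<and> best_inv i ?\<Psi> s"
    have "best_inv i (\<lambda>m. \<Phi> m \<and> dominates S m i k l j) s"
      by (rule best_inv_mono[OF conjunct2[OF s]]) (use dominatesI[OF u(2) v(2)] in blast)
    moreover have "fst s rV = n - i" "fst s rK = k" "fst s rL = l" "fst s rJ = j"
      using s upd_reg[of "{n + i}" s0 s] inv J by (auto simp: loop_inv_def)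
    moreover have "cells_before i k l N k l s" using cell s by (simp add: cells_before_def)
    ultimately show "(loop_inv i k l (\<lambda>m. \<Phi> m \<and> dominates S m i k l j) s \<and> cells_before i k l N k l s) \<and> fst s rJ = j"
      by (simp add: loop_inv_def)
  qed simp_all
qed

lemma tri_try_ends:
  assumes le: "i \<le> k" "k \<le> l" "l \<le> n"
    and mono: "\<And>m m'. \<Phi> m \<Longrightarrow> m \<le> m' \<Longrightarrow> \<Phi> m'"
  shows "tri (\<lambda>s. loop_inv i k l \<Phi> s \<and> cells_before i k l N k l s) try_ends (614 * N ^ 2)
    (loop_inv i k l (\<lambda>m. \<Phi> m \<and> (\<forall>j \<in> {l..n}. dominates S m i k l j)))"
proof -
  \<comment> \<open>The half-open range is empty on entry at \<open>l\<close> and has become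
    \<open>{l..n}\<close> on exit at \<open>N\<close>.\<close>
  let ?\<Phi> = "\<lambda>x m. \<Phi> m \<and> (\<forall>j \<in> {l..<x}. dominates S m i k l j)"
  let ?I = "\<lambda>x s. loop_inv i k l (?\<Phi> x) s \<and> cells_before i k l N k l s"
  have "tri (?I l) try_ends ((600 + 14) * N ^ Suc 1) (?I N)"
    unfolding try_ends_def
  proof (rule tri_For)
    fix j assume j: "l \<le> j" "j \<le> n"
    have mono': "?\<Phi> j m'" if "?\<Phi> j m" "m \<le> m'" for m m'
      using that mono dominates_mono by blast
    have eq: "(\<lambda>m. ?\<Phi> j m \<and> dominates S m i k l j) = ?\<Phi> (Suc j)"
      using j by (auto simp: fun_eq_iff less_Suc_eq)
    show "tri (\<lambda>s. ?I j s \<and> fst s rJ = j)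
      (Seq (try_power (lcs_at (Reg rK) (Reg rL) (Reg rJ)) 3) (try_power (lcs_at (Reg rK) (Reg rJ) (Reg rJ)) 2))
      (600 * N ^ 1) (\<lambda>s. ?I (Suc j) s \<and> fst s rJ = j)"
      using tri_try_ends_body[OF le(1,2) j, of "?\<Phi> j", OF mono'] unfolding eq .
  qed (use le in \<open>auto simp: loop_inv_reg cells_before_reg dest: loop_inv_regs\<close>)
  moreover have "{l..<N} = {l..n}" by auto
  ultimately show ?thesis by (elim tri_conseq) (simp_all add: eval_nat_numeral)
qed

text \<open>The suffixes of length below \<open>x\<close> are done. The additive form matters for
  \<open>x = n + 1\<close>: with \<open>n - x < j\<close>, truncated subtraction would leave out
  \<open>j = 0\<close>.\<close>

definition solved_from :: "nat \<Rightarrow> state \<Rightarrow> bool" where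
  "solved_from x s \<longleftrightarrow> base s \<and> (\<forall>j. n < j + x \<longrightarrow> j \<le> n \<longrightarrow> (\<exists>y. lst s (snd s (n + j)) y \<and> opt_suffix S j y))"

lemma tri_start:
  assumes "x \<le> n"
  shows "tri (\<lambda>s. solved_from x s \<and> fst s rV = x) start 20 (\<lambda>s. best_inv (n - x) (\<lambda>m. True) s \<and> fst s rV = x)"
proof (rule tri_straight)
  fix s assume s: "solved_from x s \<and> fst s rV = x"
  let ?i = "n - x"
  have b: "base s" using s by (simp add: solved_from_def)
  have "n \<le> M" using le_4n_M[of n] by simp
  then have "x < 2 ^ w" "?i \<le> M" using assms M_less by simp_all
  have "n + (2 ^ w - x) = ?i + 2 ^ w" using assms \<open>x < 2 ^ w\<close> by simp
  then have "(n + (2 ^ w - x)) mod 2 ^ w = ?i" using \<open>?i \<le> M\<close> by (simp only: mod_add_self2) simp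
  then have i: "exp_val w (Bin Minus (Reg 0) (Reg rV)) s = ?i"
    using s b unfolding exp_val.simps binop_val.simps by (simp only: base_def)
  let ?s = "((fst s)(rI := ?i), snd s)"
  have bs: "base ?s" using b by (simp add: base_reg)
  have ad: "exp_val w (best_at (Reg rI)) ?s = n + ?i" using exp_val_best_at[OF bs, of "Reg rI"] by simp
  define s' where "s' = (fst ?s, (snd ?s)(n + ?i := null_addr n))"
  have run: "run w start s = s'" using i ad b by (simp add: start_def s'_def base_def)
  have u: "upd {n + ?i} ?s s'" by (simp add: upd_def s'_def)
  have low: "{n + ?i} \<subseteq> {..<null_addr n}" using less_null_addr[of "n + ?i" n] by simp
  have b': "base s'" by (rule upd_base[OF u bs _ low]) simp
  have "\<exists>y. lst s' (snd s' (n + j)) y \<and> opt_suffix S j y" if j: "?i < j" "j \<le> n" for j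
  proof -
    have "n < j + x" using j by simp
    then obtain y where y: "lst s (snd s (n + j)) y" "opt_suffix S j y"
      using s j unfolding solved_from_def by blast
    have "lst ?s (snd s (n + j)) y" using y(1) by (simp add: lst_reg)
    from upd_lst[OF u low this] j y(2) show ?thesis by (auto simp: s'_def)
  qed
  moreover have "lst s' (snd s' (n + ?i)) []" using base_null[OF b'] by (simp add: s'_def)
  then have "\<exists>y. lst s' (snd s' (n + ?i)) y \<and> pow_concat y \<and> subseq y (drop ?i S) \<and> True"
    using pow_concat.Nil list_emb_Nil by blast
  moreover have "fst s' rI = ?i" by (simp add: s'_def)
  ultimately have "best_inv ?i (\<lambda>m. True) s'"
    using b' unfolding best_inv_def by blast
  then show "fst (run w start s) rH \<le> fst s rH + 20 \<and> best_inv ?i (\<lambda>m. True) (run w start s) \<and> fst (run w start s) rV = x"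
    unfolding run using s by (simp add: s'_def)
qed (simp_all add: start_def)

text \<open>The collected bounds cover all \<open>l\<close> and \<open>j\<close> for the completed
  values of \<open>k\<close>, and for the current \<open>k\<close> those \<open>l\<close> that the
  inner loop has passed. The constant is \<open>1100 + 2 * 14\<close>, where 1100 absorbs
  \<open>442 * N ^ 3 + 614 * N ^ 2\<close>.\<close>

lemma tri_candidates:
  assumes i: "i \<le> n"
  shows "tri (\<lambda>s. best_inv i (\<lambda>m. True) s \<and> fst s rV = n - i)
     (For rK (Reg rI) (For rL (Reg rK) (Seq fill_table try_ends))) (1128 * N ^ 5)
     (\<lambda>s. best_inv i (\<lambda>m. \<forall>k \<in> {i..n}. \<forall>l \<in> {k..n}. \<forall>j \<in> {l..n}. dominates S m i k l j) s \<and> fst s rV = n - i)"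
proof -
  let ?\<Phi> = "\<lambda>x m. \<forall>k \<in> {i..<x}. \<forall>l \<in> {k..n}. \<forall>j \<in> {l..n}. dominates S m i k l j"
  let ?\<Psi> = "\<lambda>k x m. ?\<Phi> k m \<and> (\<forall>l \<in> {k..<x}. \<forall>j \<in> {l..n}. dominates S m i k l j)"
  let ?K = "\<lambda>x s. best_inv i (?\<Phi> x) s \<and> fst s rV = n - i"
  let ?L = "\<lambda>k x s. best_inv i (?\<Psi> k x) s \<and> fst s rV = n - i \<and> fst s rK = k"
  have N: "{k..<N} = {k..n}" for k by auto
  have L: "tri (?L k k) (For rL (Reg rK) (Seq fill_table try_ends)) ((1100 + 14) * N ^ Suc 3) (?L k N)"
    if k: "i \<le> k" "k \<le> n" for k
  proof (rule tri_For)
    fix l assume l: "k \<le> l" "l \<le> n"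
    have mono: "?\<Psi> k l m'" if "?\<Psi> k l m" "m \<le> m'" for m m'
      using that dominates_mono by blast
    have eq: "(\<lambda>m. ?\<Psi> k l m \<and> (\<forall>j \<in> {l..n}. dominates S m i k l j)) = ?\<Psi> k (Suc l)"
      using l by (auto simp: fun_eq_iff less_Suc_eq)
    have "tri (loop_inv i k l (?\<Psi> k l)) (Seq fill_table try_ends) (442 * N ^ 3 + 614 * N ^ 2) (loop_inv i k l (?\<Psi> k (Suc l)))"
      using tri_Seq[OF tri_fill_table[OF k(1) l] tri_try_ends[OF k(1) l, of "?\<Psi> k l", OF mono]] unfolding eq .
    then show "tri (\<lambda>s. ?L k l s \<and> fst s rL = l) (Seq fill_table try_ends) (1100 * N ^ 3) (\<lambda>s. ?L k (Suc l) s \<and> fst s rL = l)"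
    proof (rule tri_conseq)
      have "N ^ 2 \<le> N ^ 3" by (rule power_increasing) simp_all
      then show "442 * N ^ 3 + 614 * N ^ 2 \<le> 1100 * N ^ 3" by linarith
    qed (simp_all add: loop_inv_def)
  qed (use k in \<open>auto simp: best_inv_reg, auto simp: best_inv_def base_def\<close>)
  have "tri (?K i) (For rK (Reg rI) (For rL (Reg rK) (Seq fill_table try_ends))) ((1100 + 14 + 14) * N ^ Suc (Suc 3)) (?K N)"
  proof (rule tri_For)
    fix k assume k: "i \<le> k" "k \<le> n"
    have eq: "?\<Psi> k k = ?\<Phi> k" "?\<Psi> k N = ?\<Phi> (Suc k)"
      unfolding N using k by (auto simp: fun_eq_iff less_Suc_eq)
    show "tri (\<lambda>s. ?K k s \<and> fst s rK = k) (For rL (Reg rK) (Seq fill_table try_ends)) ((1100 + 14) * N ^ Suc 3)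
        (\<lambda>s. ?K (Suc k) s \<and> fst s rK = k)"
      using L[OF k] unfolding eq by (rule tri_conseq) simp_all
  qed (use i in \<open>auto simp: best_inv_reg, auto simp: best_inv_def base_def\<close>)
  then show ?thesis unfolding N by (rule tri_conseq) (simp_all add: eval_nat_numeral)
qed

lemma tri_solve: "tri (solved_from 0) solve (1164 * N ^ 6) (solved_from N)"
proof -
  have "tri (solved_from 0) solve ((1150 + 14) * N ^ Suc 5) (solved_from N)"
    unfolding solve_def
  proof (rule tri_For)
    fix x assume x: "x \<le> n"
    let ?i = "n - x"
    have i: "?i \<le> n" "n - ?i = x" using x by simp_all
    from tri_Seq[OF tri_start[OF x] tri_candidates[OF i(1), unfolded i(2)]]
    show "tri (\<lambda>s. solved_from x s \<and> fst s rV = x)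
      (Seq start (For rK (Reg rI) (For rL (Reg rK) (Seq fill_table try_ends)))) (1150 * N ^ 5)
      (\<lambda>s. solved_from (Suc x) s \<and> fst s rV = x)"
    proof (rule tri_conseq)
      show "20 + 1128 * N ^ 5 \<le> 1150 * N ^ 5"
        using one_le_power[of N 5] by linarith
      fix s assume s: "best_inv ?i (\<lambda>m. \<forall>k \<in> {?i..n}. \<forall>l \<in> {k..n}. \<forall>j \<in> {l..n}. dominates S m ?i k l j) s \<and> fst s rV = x"
      then obtain y where y: "lst s (snd s (n + ?i)) y" "pow_concat y" "subseq y (drop ?i S)"
        "\<forall>k \<in> {?i..n}. \<forall>l \<in> {k..n}. \<forall>j \<in> {l..n}. dominates S (length y) ?i k l j"
        unfolding best_inv_def by blast
      \<comment> \<open>The loops only produced length bounds; here they are turned into optimality,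
        which makes this entry usable as a tail for longer suffixes.\<close>
      have "opt_suffix S ?i y" by (rule opt_suffixI[OF y(2,3) i(1)]) (use y(4) in simp)
      have "\<exists>y. lst s (snd s (n + j)) y \<and> opt_suffix S j y" if "n < j + Suc x" "j \<le> n" for j
      proof (cases "j = ?i")
        case True
        then show ?thesis using y(1) \<open>opt_suffix S ?i y\<close> by blast
      next
        case False
        then have "?i < j" using that by linarith
        then show ?thesis using s that unfolding best_inv_def by blast
      qed
      then show "solved_from (Suc x) s \<and> fst s rV = x" using s by (simp add: solved_from_def best_inv_def)
    qed simp
  qed (auto simp: solved_from_def base_reg lst_reg, auto simp: base_def)
  then show ?thesis by (rule tri_conseq) (simp_all add: eval_nat_numeral)
qed

section \<open>Output, initial state and the whole program\<close>

lemma tri_write_best: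
  "tri (solved_from N) write_best (50 * N) (\<lambda>s. is_LSRS S (output_string s))"
proof (rule tri_state)
  fix s0 assume s0: "solved_from N s0"
  then obtain y where y: "lst s0 (snd s0 n) y" "opt_suffix S 0 y"
    unfolding solved_from_def by force
  have b: "base s0" using s0 by (simp add: solved_from_def)
  have len: "length y \<le> n" using y(2) list_emb_length[of _ y S] by (auto simp: opt_suffix_iff)
  have nM: "n < M" using M_ge less_null_addr[of n n] by simp
  let ?I = "\<lambda>k s. lst s (fst s rP) (drop (fst s rX) y) \<and> fst s 0 = length y \<and> fst s rX + k = length y \<and>
     (\<forall>x < fst s rX. snd s x = y ! x)"
  let ?pre = "Seq (Assign rP (Load (Reg 0))) (Seq (Assign 0 (Load (Reg rP))) (Assign rX (Const 0)))"
  have "tri (\<lambda>s. s = s0) ?pre 8 (?I (length y))"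
  proof (rule tri_straight)
    fix s assume "s = s0"
    then show "fst (run w ?pre s) rH \<le> fst s rH + 8 \<and> ?I (length y) (run w ?pre s)"
      using b y(1) lst_length[OF y(1)] by (simp add: base_def lst_reg)
  qed simp_all
  moreover have "tri (?I (length y)) (While (Bin Less (Reg rX) (Reg 0)) write_body)
     (length y * (1 + exp_time (Bin Less (Reg rX) (Reg 0)) + 20) + (1 + exp_time (Bin Less (Reg rX) (Reg 0)))) (?I 0)"
  proof (rule tri_While)
    fix k
    show "tri (?I (Suc k)) write_body 20 (?I k)"
    proof (rule tri_straight)
      fix s assume s: "?I (Suc k) s" and H: "fst s rH + 20 \<le> M"
      let ?x = "fst s rX" and ?p = "fst s rP"
      have x: "?x < length y" using s by simp
      then have "drop ?x y = y ! ?x # drop (Suc ?x) y" by (simp add: Cons_nth_drop_Suc)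
      with s have p: "null_addr n < ?p" "?p + 2 < fst s rH" "snd s (?p + 1) = y ! ?x"
        "lst s (snd s (?p + 2)) (drop (Suc ?x) y)" by auto
      have low: "?x < null_addr n" "?x + 1 \<le> M" using x len nM less_null_addr[of ?x n] by auto
      define s' where "s' = ((fst s)(rP := snd s (?p + 2), rX := ?x + 1), (snd s)(?x := y ! ?x))"
      have run: "run w write_body s = s'"
        using p low H by (simp add: write_body_def s'_def)
      have "lst s' (snd s (?p + 2)) (drop (Suc ?x) y)"
        \<comment> \<open>The output overwrites the input, in cells below
          \<open>null_addr n\<close>, so the part of the list still to be written survives.\<close>
        by (rule lst_frame[OF p(4)]) (use low in \<open>auto simp: s'_def\<close>)
      then show "fst (run w write_body s) rH \<le> fst s rH + 20 \<and> ?I k (run w write_body s)"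
        unfolding run using s by (auto simp: s'_def less_Suc_eq)
    qed (simp_all add: write_body_def)
  qed auto
  ultimately have "tri (\<lambda>s. s = s0) write_best (8 +
     (length y * (1 + exp_time (Bin Less (Reg rX) (Reg 0)) + 20) + (1 + exp_time (Bin Less (Reg rX) (Reg 0))))) (?I 0)"
    unfolding write_best_def by (rule tri_Seq)
  then show "tri (\<lambda>s. s = s0) write_best (50 * N) (\<lambda>s. is_LSRS S (output_string s))"
  proof (rule tri_conseq)
    show "8 + (length y * (1 + exp_time (Bin Less (Reg rX) (Reg 0)) + 20) + (1 + exp_time (Bin Less (Reg rX) (Reg 0)))) \<le> 50 * N"
      using len by simp
    fix s assume s: "?I 0 s"
    then have "output_string s = y" by (auto simp: output_string_def intro: nth_equalityI)
    then show "is_LSRS S (output_string s)" using y(2) by (simp add: is_LSRS_iff)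
  qed simp
qed

lemma run_init:
  "solved_from 0 (run w init (input_state S))" "fst (run w init (input_state S)) rH = null_addr n + 3"
proof -
  have small: "2 * n + 1 \<le> M" "N \<le> M" "null_addr n \<le> M" using M_ge by (simp_all add: null_addr_def tcell_def)
  let ?s = "((fst (input_state S))(rN := N, rT := 2 * n + 1), snd (input_state S))"
  have ad: "exp_val w (lcs_at (Reg rN) (Const 0) (Const 0)) ?s = null_addr n"
    using exp_val_lcs_at[of ?s "Reg rN" N "Const 0" 0 "Const 0" 0] small by (simp add: null_addr_def)
  have run: "run w init (input_state S) =
     ((fst (input_state S))(rN := N, rT := 2 * n + 1, rZ := null_addr n, rH := null_addr n + 3), snd (input_state S))"
    using small M_ge ad by (simp add: init_def input_state_def mult_2)
  have "\<not> null_addr n < n" using less_null_addr[of n n] by simp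
  then show "solved_from 0 (run w init (input_state S))" unfolding run
    by (simp add: solved_from_def base_def input_state_def)
  show "fst (run w init (input_state S)) rH = null_addr n + 3" unfolding run by simp
qed

text \<open>Solving and writing take at most \<open>1164 + 50\<close> times \<open>N ^ 6\<close>,
  within the heap budget 1250; \<open>init\<close> adds at most 50 to the time, within 1300.\<close>

lemma exec_lsrs:
  assumes "null_addr n + 3 + 1250 * N ^ 6 \<le> M"
  shows "\<exists>t s. exec w lsrs (input_state S) t s \<and> t \<le> 1300 * N ^ 6 \<and> is_LSRS S (output_string s)"
proof -
  have N: "1 \<le> N ^ 6" "N \<le> N ^ 6" by (simp_all add: self_le_power del: power_Suc)
  let ?s = "run w init (input_state S)"
  obtain t1 where t1: "t1 \<le> straight_time init" "exec w init (input_state S) t1 ?s"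
    using exec_run[of init w "input_state S"] by auto
  from tri_Seq[OF tri_solve tri_write_best] run_init(1)
  obtain t2 s2 where 2: "exec w (Seq solve write_best) ?s t2 s2" "t2 \<le> 1164 * N ^ 6 + 50 * N" "is_LSRS S (output_string s2)"
    by (rule triD) (use run_init(2) N assms in simp)
  have "straight_time init \<le> 50" by (simp add: init_def)
  moreover have "t1 + t2 \<le> 1300 * p" if "N \<le> p" "1 \<le> p" "t2 \<le> 1164 * p + 50 * N" "t1 \<le> 50" for p
  proof -
    have "50 * N \<le> 50 * p" using that(1) by (rule mult_le_mono2)
    with that(2-) show ?thesis by linarith
  qed
  ultimately have "t1 + t2 \<le> 1300 * N ^ 6" using t1(1) 2(2) N le_trans by blast
  with exec.Seq[OF t1(2) 2(1)] 2(3) show ?thesis unfolding lsrs_def by blast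
qed

end

text \<open>Everything is at most \<open>3 + 3 + 1250 = 1256\<close> times \<open>Suc n ^ 6\<close>.
  The constant must be absorbed even for \<open>n = 0\<close>, where the base is only 2: since
  \<open>1256 < 2 ^ 11\<close>, eleven further factors \<open>n + 2\<close> suffice, and
  \<open>11 + 6 = 17\<close>.\<close>

lemma word_size_bound: "null_addr n + 3 + 1250 * Suc n ^ 6 < (n + 2) ^ 17"
proof -
  have "null_addr n \<le> 3 * Suc n ^ 6"
  proof -
    have "Suc n ^ 1 \<le> Suc n ^ 6" "Suc n ^ 3 \<le> Suc n ^ 6" by (rule power_increasing; simp)+
    moreover have "null_addr n \<le> 2 * Suc n ^ 1 + Suc n ^ 3"
      by (simp add: null_addr_def tcell_def power3_eq_cube)
    ultimately show ?thesis by linarith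
  qed
  moreover have "1 \<le> Suc n ^ 6" by simp
  ultimately have "null_addr n + 3 + 1250 * Suc n ^ 6 \<le> 1256 * Suc n ^ 6" by linarith
  also have "\<dots> < 2 ^ 11 * (n + 2) ^ 6"
    by (intro mult_less_le_imp_less power_mono) simp_all
  also have "\<dots> \<le> (n + 2) ^ 11 * (n + 2) ^ 6"
    by (intro mult_le_mono1 power_mono) simp_all
  also have "\<dots> = (n + 2) ^ 17" by (simp flip: power_add)
  finally show ?thesis .
qed

lemma time_bigo: "(\<lambda>n. real (1300 * Suc n ^ 6)) \<in> O(\<lambda>n. real n ^ 6)"
proof (rule bigoI)
  show "\<forall>\<^sub>F n in sequentially. norm (real (1300 * Suc n ^ 6)) \<le> (1300 * 2 ^ 6) * norm (real n ^ 6)"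
    using eventually_ge_at_top[of 1]
  proof eventually_elim
    fix n :: nat assume "1 \<le> n"
    then have "real (Suc n) ^ 6 \<le> (2 * real n) ^ 6" by (intro power_mono) simp_all
    then show "norm (real (1300 * Suc n ^ 6)) \<le> (1300 * 2 ^ 6) * norm (real n ^ 6)"
      by (simp add: power_mult_distrib)
  qed
qed

theorem theorem2:
  "\<exists>(P :: com) (c :: nat) (T :: nat \<Rightarrow> nat).
     (\<lambda>n. real (T n)) \<in> O(\<lambda>n. real n ^ 6) \<and>
     (\<forall>(\<Sigma> :: nat set) S w.
        finite \<Sigma> \<longrightarrow> S \<in> lists \<Sigma> \<longrightarrow> admissible_word_size c \<Sigma> (length S) w \<longrightarrow>
        (\<exists>t s. exec w P (input_state S) t s \<and> t \<le> T (length S) \<and>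
               is_LSRS S (output_string s)))"
proof (rule exI[of _ lsrs], rule exI[of _ 17], rule exI[of _ "\<lambda>n. 1300 * Suc n ^ 6"], intro conjI allI impI)
  show "(\<lambda>n. real (1300 * Suc n ^ 6)) \<in> O(\<lambda>n. real n ^ 6)" by (rule time_bigo)
  fix \<Sigma> :: "nat set" and S :: "nat list" and w :: nat
  assume "admissible_word_size 17 \<Sigma> (length S) w"
  then have "null_addr (length S) + 3 + 1250 * Suc (length S) ^ 6 < 2 ^ w"
    using word_size_bound[of "length S"] unfolding admissible_word_size_def by linarith
  \<comment> \<open>The budget \<open>M\<close> is the bound on the final heap end itself; the
    exponent 17 puts it below \<open>2 ^ w\<close>.\<close>
  then interpret lsrs_ram S w "null_addr (length S) + 3 + 1250 * Suc (length S) ^ 6"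
    by unfold_locales simp_all
  show "\<exists>t s. exec w lsrs (input_state S) t s \<and> t \<le> 1300 * Suc (length S) ^ 6 \<and> is_LSRS S (output_string s)"
    by (rule exec_lsrs) simp
qed

end
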